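(* Let $(E,u)$ be a pointed inclusion system. Let $\mathcal{E}$ be the product system generated by $E$, with canonical isometries $\imath_t:E_t\to\mathcal{E}_t$ ($t>0$), and let $\widehat{u}$ be the lift of $u$. Then the following hold. (a) The map $b=(b_t)_{t>0}\mapsto(\imath_t^*b_t)_{t>0}$ restricts to a bijection from the set of addits of $(\mathcal{E},\widehat{u})$ to the set of addits of $(E,u)$, whose inverse is denoted by $a\mapsto\widehat{a}$. (b) If $a$ is a root of $(E,u)$ then $\widehat{a}$ is a root of $(\mathcal{E},\widehat{u})$.
   Context: An inclusion system $E$ is a family $(E_t)_{t>0}$ of Hilbert spaces with isometries $\beta_{s,t}:E_{s+t}\to E_s\otimes E_t$ ($s,t>0$) satisfying $(I_{E_r}\otimes\beta_{s,t})\beta_{r,s+t}=(\beta_{r,s}\otimes I_{E_t})\beta_{r+s,t}$. A product system is an inclusion system whose structure maps are unitary. A unit of an inclusion system $E$ is a nonzero section $u$ with $u_{s+t}=\beta_{s,t}^*(u_s\otimes u_t)$ for all $s,t>0$ which is quasicontractive: $e^{-kt}\|u_t\|\le1$ ($t>0$) for some $k\in\mathbb{R}$. It is normalised if $\|u_t\|=1$ for all $t$. A pointed inclusion system $(E,u)$ is an inclusion system with a normalised unit $u$. An addit of $(E,u)$ is a section $a$ of $E$ with $a_{s+t}=\beta_{s,t}^*(a_s\otimes u_t+u_s\otimes a_t)$ ($s,t>0$) for which there is $k\ge0$ with $\|a_t\|^2\le k(t+t^2)$ ($t>0$). A root is an addit $a$ with $a_t\perp u_t$ for all $t>0$. These definitions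 apply in particular to $(\mathcal{E},\widehat{u})$, $\mathcal{E}$ being a product system and hence an inclusion system. Generated product system: for $T>0$ let $J_T$ be the set of all finite tuples $\mathbf{t}=(t_1,\dots,t_n)$, $n\ge1$, of positive numbers with sum $T$, and let $\smile$ denote concatenation of tuples. For $\mathbf{r}=(r_1,\dots,r_m)$ and $\mathbf{s}$ in $J_T$ write $\mathbf{s}\ge\mathbf{r}$ if $\mathbf{s}=\mathbf{r}_1\smile\cdots\smile\mathbf{r}_m$ with $\mathbf{r}_i\in J_{r_i}$; this makes $J_T$ a directed set. Put $E_{\mathbf{t}}=E_{t_1}\otimes\cdots\otimes E_{t_n}$. For $\mathbf{r}=(r_1,\dots,r_p)\in J_R$ let $\beta_{R,\mathbf{r}}:E_R\to E_{\mathbf{r}}$ be the identity if $p=1$ and otherwise the iterated structure map $(I_{E_{r_1}}\otimes\cdots\otimes I_{E_{r_{p-2}}}\otimes\beta_{r_{p-1},r_p})\cdots(I_{E_{r_1}}\otimes\beta_{r_2,r_3+\cdots+r_p})\beta_{r_1,r_2+\cdots+r_p}$. For $\mathbf{s}=(s_1,\dots,s_m)\le\mathbf{t}=\mathbf{s}_1\smile\cdots\smile\mathbf{s}_m$ put $\beta_{\mathbf{s},\mathbf{t}}=\beta_{s_1,\mathbf{s}_1}\otimes\cdots\otimes\beta_{s_m,\mathbf{s}_m}$. Then $\mathcal{E}_T$, with canonical isometries $\imath_{\mathbf{t}}:E_{\mathbf{t}}\to\mathcal{E}_T$, is the Hilbert space inductive limit of $((E_{\mathbf{t}})_{\mathbf{t}\in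 J_T},(\beta_{\mathbf{s},\mathbf{t}})_{\mathbf{s}\le\mathbf{t}})$. The (unitary) structure maps $B_{S,T}:\mathcal{E}_{S+T}\to\mathcal{E}_S\otimes\mathcal{E}_T$ are determined by $B_{S,T}\circ\imath_{\mathbf{s}\smile\mathbf{t}}=\imath_{\mathbf{s}}\otimes\imath_{\mathbf{t}}$ ($\mathbf{s}\in J_S,\mathbf{t}\in J_T$). Write $\imath_T:=\imath_{(T)}$. It is known that $v\mapsto(\imath_t^*v_t)_{t>0}$ is a bijection from units of $\mathcal{E}$ to units of $E$; the lift $\widehat{u}$ of a unit $u$ of $E$ is the unique unit of $\mathcal{E}$ with $\imath_t^*\widehat{u}_t=u_t$ for all $t$. The lift is normalised if $u$ is. *)

theory Defs
  imports "HOL-Analysis.Analysis"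
begin

section \<open>Complex Hilbert spaces\<close>

text \<open>The inner product is antilinear in the first and linear in the second variable.\<close>

class chilbert_space = banach +
  fixes scaleC :: "complex \<Rightarrow> 'a \<Rightarrow> 'a"
    and cinner :: "'a \<Rightarrow> 'a \<Rightarrow> complex"
  assumes scaleC_add_right: "scaleC c (x + y) = scaleC c x + scaleC c y"
    and scaleC_add_left: "scaleC (c + d) x = scaleC c x + scaleC d x"
    and scaleC_scaleC: "scaleC c (scaleC d x) = scaleC (c * d) x"
    and scaleC_one: "scaleC 1 x = x"
    and scaleC_of_real: "scaleC (complex_of_real r) x = scaleR r x"
    and cinner_commute: "cinner x y = cnj (cinner y x)"
    and cinner_add_right: "cinner x (y + z) = cinner x y + cinner x z"
    and cinner_scaleC_right: "cinner x (scaleC c y) = c * cinner x y"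
    and cinner_self: "cinner x x = complex_of_real ((norm x)\<^sup>2)"

global_interpretation complex_vs: vector_space "scaleC :: complex \<Rightarrow> 'a \<Rightarrow> 'a :: chilbert_space"
  defines csubspace_def: csubspace = complex_vs.subspace
    and cspan_def: cspan = complex_vs.span
  by unfold_locales (simp_all add: scaleC_add_right scaleC_add_left scaleC_scaleC scaleC_one)

text \<open>Families of Hilbert spaces are families of closed subspaces of an ambient Hilbert space
  of arbitrary type (for a given family, think of its Hilbert space direct sum). The relative
  position of the members inside the ambient space is never used.\<close>

definition hilbert_subspace :: "'a::chilbert_space set \<Rightarrow> bool" where
  "hilbert_subspace H \<longleftrightarrow> csubspace H \<and> closed H"

definition clinear_on :: "'a::chilbert_space set \<Rightarrow> ('a \<Rightarrow> 'b::chilbert_space) \<Rightarrow> bool" where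
  "clinear_on H f \<longleftrightarrow> (\<forall>x\<in>H. \<forall>y\<in>H. f (x + y) = f x + f y) \<and>
     (\<forall>c. \<forall>x\<in>H. f (scaleC c x) = scaleC c (f x))"

definition bounded_clinear_on :: "'a::chilbert_space set \<Rightarrow> ('a \<Rightarrow> 'b::chilbert_space) \<Rightarrow> bool" where
  "bounded_clinear_on H f \<longleftrightarrow> clinear_on H f \<and> (\<exists>K. \<forall>x\<in>H. norm (f x) \<le> K * norm x)"

definition isometry_on ::
    "'a::chilbert_space set \<Rightarrow> 'b::chilbert_space set \<Rightarrow> ('a \<Rightarrow> 'b) \<Rightarrow> bool" where
  "isometry_on H K V \<longleftrightarrow> clinear_on H V \<and> V ` H \<subseteq> K \<and> (\<forall>x\<in>H. norm (V x) = norm x)"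

definition unitary_on ::
    "'a::chilbert_space set \<Rightarrow> 'b::chilbert_space set \<Rightarrow> ('a \<Rightarrow> 'b) \<Rightarrow> bool" where
  "unitary_on H K V \<longleftrightarrow> isometry_on H K V \<and> V ` H = K"

text \<open>\<open>adjoint_on H V\<close> is the Hilbert space adjoint of a bounded operator \<open>V\<close> with domain \<open>H\<close>.\<close>

definition adjoint_on ::
    "'a::chilbert_space set \<Rightarrow> ('a \<Rightarrow> 'b::chilbert_space) \<Rightarrow> 'b \<Rightarrow> 'a" where
  "adjoint_on H V y = (THE z. z \<in> H \<and> (\<forall>x\<in>H. cinner z x = cinner y (V x)))"


section \<open>Tensor products\<close>

text \<open>\<open>hilbert_tensor H K \<tau> T\<close>: the space \<open>T\<close> with the bilinear map \<open>\<tau> x y = x \<otimes> y\<close> is a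
  realisation of the Hilbert space tensor product of \<open>H\<close> and \<open>K\<close>, i.e. the completion of the
  algebraic one for the inner product \<open>\<langle>x \<otimes> y, x' \<otimes> y'\<rangle> = \<langle>x, x'\<rangle> \<langle>y, y'\<rangle>\<close>.\<close>

definition hilbert_tensor ::
    "'a::chilbert_space set \<Rightarrow> 'b::chilbert_space set \<Rightarrow> ('a \<Rightarrow> 'b \<Rightarrow> 'c) \<Rightarrow>
     'c::chilbert_space set \<Rightarrow> bool" where
  "hilbert_tensor H K \<tau> T \<longleftrightarrow>
     hilbert_subspace H \<and> hilbert_subspace K \<and> hilbert_subspace T \<and>
     (\<forall>x\<in>H. clinear_on K (\<tau> x)) \<and> (\<forall>y\<in>K. clinear_on H (\<lambda>x. \<tau> x y)) \<and>
     (\<forall>x\<in>H. \<forall>x'\<in>H. \<forall>y\<in>K. \<forall>y'\<in>K.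
        cinner (\<tau> x y) (\<tau> x' y') = cinner x x' * cinner y y') \<and>
     T = closure (cspan {\<tau> x y | x y. x \<in> H \<and> y \<in> K})"

text \<open>Finite tuples of positive numbers with sum \<open>T\<close>; concatenation of tuples is \<open>@\<close>.\<close>

definition J :: "real \<Rightarrow> real list set" where
  "J T = {ts. ts \<noteq> [] \<and> (\<forall>t\<in>set ts. 0 < t) \<and> sum_list ts = T}"

definition tuples :: "real list set" where
  "tuples = (\<Union>T. J T)"

text \<open>Data of a family \<open>(E\<^sub>t)\<close> with structure maps: \<open>sp E [t\<^sub>1, \<dots>, t\<^sub>n]\<close> is
  \<open>E\<^bsub>t\<^sub>1\<^esub> \<otimes> \<cdots> \<otimes> E\<^bsub>t\<^sub>n\<^esub>\<close>, so that \<open>sp E [t]\<close> is \<open>E\<^sub>t\<close> itself, \<open>ten E r s x y\<close> is \<open>x \<otimes> y\<close> for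
  \<open>x\<close> in \<open>sp E r\<close> and \<open>y\<close> in \<open>sp E s\<close>, and \<open>str E s t\<close> is the structure map from
  \<open>E\<^bsub>s+t\<^esub>\<close> to \<open>E\<^sub>s \<otimes> E\<^sub>t\<close>. Tensor products are identified so as to be strictly associative.\<close>

record 'a tensor_system =
  sp :: "real list \<Rightarrow> 'a set"
  ten :: "real list \<Rightarrow> real list \<Rightarrow> 'a \<Rightarrow> 'a \<Rightarrow> 'a"
  str :: "real \<Rightarrow> real \<Rightarrow> 'a \<Rightarrow> 'a"

definition tensor_family :: "'a::chilbert_space tensor_system \<Rightarrow> bool" where
  "tensor_family E \<longleftrightarrow>
     (\<forall>r\<in>tuples. hilbert_subspace (sp E r)) \<and>
     (\<forall>r\<in>tuples. \<forall>s\<in>tuples. hilbert_tensor (sp E r) (sp E s) (ten E r s) (sp E (r @ s))) \<and>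
     (\<forall>r\<in>tuples. \<forall>s\<in>tuples. \<forall>t\<in>tuples. \<forall>x\<in>sp E r. \<forall>y\<in>sp E s. \<forall>z\<in>sp E t.
        ten E (r @ s) t (ten E r s x y) z = ten E r (s @ t) x (ten E s t y z))"

text \<open>\<open>tensor_op E r s \<tau>' A V\<close> is the operator \<open>A \<otimes> V\<close> on \<open>sp E r \<otimes> sp E s\<close>, where \<open>\<tau>'\<close> is the
  tensor product of vectors on the target side.\<close>

definition tensor_op ::
    "'a::chilbert_space tensor_system \<Rightarrow> real list \<Rightarrow> real list \<Rightarrow> ('b \<Rightarrow> 'b \<Rightarrow> 'b) \<Rightarrow>
     ('a \<Rightarrow> 'b) \<Rightarrow> ('a \<Rightarrow> 'b) \<Rightarrow> 'a \<Rightarrow> 'b::chilbert_space" where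
  "tensor_op E r s \<tau>' A V =
     (THE f. f \<in> extensional (sp E (r @ s)) \<and> bounded_clinear_on (sp E (r @ s)) f \<and>
        (\<forall>x\<in>sp E r. \<forall>y\<in>sp E s. f (ten E r s x y) = \<tau>' (A x) (V y)))"


section \<open>Inclusion systems, units, addits and roots\<close>

definition inclusion_system :: "'a::chilbert_space tensor_system \<Rightarrow> bool" where
  "inclusion_system E \<longleftrightarrow> tensor_family E \<and>
     (\<forall>s>0. \<forall>t>0. isometry_on (sp E [s + t]) (sp E [s, t]) (str E s t)) \<and>
     (\<forall>r>0. \<forall>s>0. \<forall>t>0. \<forall>x\<in>sp E [r + s + t].
        tensor_op E [r] [s + t] (ten E [r] [s, t]) id (str E s t) (str E r (s + t) x) =
        tensor_op E [r + s] [t] (ten E [r, s] [t]) (str E r s) id (str E (r + s) t x))"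

definition product_system :: "'a::chilbert_space tensor_system \<Rightarrow> bool" where
  "product_system E \<longleftrightarrow> inclusion_system E \<and>
     (\<forall>s>0. \<forall>t>0. unitary_on (sp E [s + t]) (sp E [s, t]) (str E s t))"

text \<open>Sections are extensional functions, hence determined by their values at \<open>t > 0\<close>.\<close>

definition sections :: "'a::chilbert_space tensor_system \<Rightarrow> (real \<Rightarrow> 'a) set" where
  "sections E = (\<Pi>\<^sub>E t\<in>{0<..}. sp E [t])"

definition str_adj :: "'a::chilbert_space tensor_system \<Rightarrow> real \<Rightarrow> real \<Rightarrow> 'a \<Rightarrow> 'a" where
  "str_adj E s t = adjoint_on (sp E [s + t]) (str E s t)"

definition units :: "'a::chilbert_space tensor_system \<Rightarrow> (real \<Rightarrow> 'a) set" where
  "units E = {u \<in> sections E. (\<exists>t>0. u t \<noteq> 0) \<and>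
     (\<forall>s>0. \<forall>t>0. u (s + t) = str_adj E s t (ten E [s] [t] (u s) (u t))) \<and>
     (\<exists>k. \<forall>t>0. exp (- k * t) * norm (u t) \<le> 1)}"

definition pointed_inclusion_system ::
    "'a::chilbert_space tensor_system \<Rightarrow> (real \<Rightarrow> 'a) \<Rightarrow> bool" where
  "pointed_inclusion_system E u \<longleftrightarrow>
     inclusion_system E \<and> u \<in> units E \<and> (\<forall>t>0. norm (u t) = 1)"

definition addits ::
    "'a::chilbert_space tensor_system \<Rightarrow> (real \<Rightarrow> 'a) \<Rightarrow> (real \<Rightarrow> 'a) set" where
  "addits E u = {a \<in> sections E.
     (\<forall>s>0. \<forall>t>0. a (s + t) =
        str_adj E s t (ten E [s] [t] (a s) (u t) + ten E [s] [t] (u s) (a t))) \<and>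
     (\<exists>k\<ge>0. \<forall>t>0. (norm (a t))\<^sup>2 \<le> k * (t + t\<^sup>2))}"

definition roots ::
    "'a::chilbert_space tensor_system \<Rightarrow> (real \<Rightarrow> 'a) \<Rightarrow> (real \<Rightarrow> 'a) set" where
  "roots E u = {a \<in> addits E u. \<forall>t>0. cinner (a t) (u t) = 0}"


section \<open>The generated product system\<close>

text \<open>The iterated structure map \<open>\<beta>\<^bsub>R,r\<^esub>\<close> from \<open>E\<^sub>R\<close> to \<open>sp E r\<close>, \<open>R\<close> being the sum of \<open>r\<close>.\<close>

fun iter_str :: "'a::chilbert_space tensor_system \<Rightarrow> real list \<Rightarrow> 'a \<Rightarrow> 'a" where
  "iter_str E [] = id"
| "iter_str E [r] = id"
| "iter_str E (r # r' # rs) =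
     tensor_op E [r] [sum_list (r' # rs)] (ten E [r] (r' # rs)) id (iter_str E (r' # rs)) \<circ>
     str E r (sum_list (r' # rs))"

text \<open>\<open>refine_str E [t\<^sub>1, \<dots>, t\<^sub>m]\<close>, with tuples \<open>t\<^sub>i\<close> of sums \<open>s\<^sub>i\<close>, is the map
  \<open>\<beta>\<^bsub>s,t\<^esub>\<close> from \<open>sp E [s\<^sub>1, \<dots>, s\<^sub>m]\<close> to \<open>sp E (t\<^sub>1 @ \<cdots> @ t\<^sub>m)\<close>.\<close>

fun refine_str :: "'a::chilbert_space tensor_system \<Rightarrow> real list list \<Rightarrow> 'a \<Rightarrow> 'a" where
  "refine_str E [] = id"
| "refine_str E [ts] = iter_str E ts"
| "refine_str E (ts # ts' # tss) =
     tensor_op E [sum_list ts] (map sum_list (ts' # tss)) (ten E ts (concat (ts' # tss)))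
       (iter_str E ts) (refine_str E (ts' # tss))"

text \<open>\<open>L\<close> with the maps \<open>\<iota> t\<close> (\<open>t \<in> J T\<close>) is a realisation of the Hilbert space inductive limit
  of the spaces \<open>sp E t\<close>: the completion of the increasing union of their images.\<close>

definition inductive_limit ::
    "'a::chilbert_space tensor_system \<Rightarrow> 'b::chilbert_space set \<Rightarrow> (real list \<Rightarrow> 'a \<Rightarrow> 'b) \<Rightarrow>
     real \<Rightarrow> bool" where
  "inductive_limit E L \<iota> T \<longleftrightarrow> hilbert_subspace L \<and>
     (\<forall>t\<in>J T. isometry_on (sp E t) L (\<iota> t)) \<and>
     (\<forall>tss. tss \<noteq> [] \<and> set tss \<subseteq> tuples \<and> concat tss \<in> J T \<longrightarrow>
        (\<forall>x\<in>sp E (map sum_list tss).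
           \<iota> (concat tss) (refine_str E tss x) = \<iota> (map sum_list tss) x)) \<and>
     L = closure (\<Union>t\<in>J T. \<iota> t ` sp E t)"

definition generated_product_system ::
    "'a::chilbert_space tensor_system \<Rightarrow> 'b::chilbert_space tensor_system \<Rightarrow>
     (real list \<Rightarrow> 'a \<Rightarrow> 'b) \<Rightarrow> bool" where
  "generated_product_system E F \<iota> \<longleftrightarrow> product_system F \<and>
     (\<forall>T>0. inductive_limit E (sp F [T]) \<iota> T) \<and>
     (\<forall>S>0. \<forall>T>0. \<forall>s\<in>J S. \<forall>t\<in>J T. \<forall>x\<in>sp E (s @ t).
        str F S T (\<iota> (s @ t) x) = tensor_op E s t (ten F [S] [T]) (\<iota> s) (\<iota> t) x)"

text \<open>The map \<open>b \<mapsto> (\<iota>\<^sub>t\<^sup>* b\<^sub>t)\<^bsub>t>0\<^esub>\<close>.\<close>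

definition compress ::
    "'a::chilbert_space tensor_system \<Rightarrow> (real list \<Rightarrow> 'a \<Rightarrow> 'b::chilbert_space) \<Rightarrow>
     (real \<Rightarrow> 'b) \<Rightarrow> real \<Rightarrow> 'a" where
  "compress E \<iota> b = (\<lambda>t\<in>{0<..}. adjoint_on (sp E [t]) (\<iota> [t]) (b t))"

definition is_lift ::
    "'a::chilbert_space tensor_system \<Rightarrow> 'b::chilbert_space tensor_system \<Rightarrow>
     (real list \<Rightarrow> 'a \<Rightarrow> 'b) \<Rightarrow> (real \<Rightarrow> 'a) \<Rightarrow> (real \<Rightarrow> 'b) \<Rightarrow> bool" where
  "is_lift E F \<iota> u v \<longleftrightarrow> v \<in> units F \<and> compress E \<iota> v = u"

end

theory Submission
  imports Defs
begin

text \<open>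
  A section \<open>b\<close> of the generated system is determined by its coordinates \<open>\<iota>\<^bsub>t\<^esub>\<^sup>* b\<^sub>T\<close> over the tuples
  \<open>t \<in> J T\<close>. For an addit \<open>b\<close> over \<open>a\<close> they are forced to be the sums \<open>a\<^sub>t\<close> of the vectors
  \<open>u\<^bsub>t\<^sub>1\<^esub> \<otimes> \<cdots> \<otimes> a\<^bsub>t\<^sub>i\<^esub> \<otimes> \<cdots> \<otimes> u\<^bsub>t\<^sub>n\<^esub>\<close>, whence injectivity. Conversely, the \<open>a\<^sub>t\<close> of an addit \<open>a\<close> are
  compatible under refinement, so they define a linear functional on the dense union of the images
  of the \<open>\<iota> t\<close>, and \<open>b\<^sub>T\<close> is its Riesz vector once the \<open>\<parallel>a\<^sub>t\<parallel>\<close> are bounded uniformly in \<open>t \<in> J T\<close>.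
  For the bound, \<open>c(t) = \<langle>a\<^sub>t, u\<^sub>t\<rangle>\<close> is additive because \<open>u\<close> is normalised (\<open>\<beta> u\<^bsub>s+t\<^esub> = u\<^sub>s \<otimes> u\<^sub>t\<close>), and
  \<open>\<parallel>a\<^sub>t\<parallel>\<^sup>2 - \<bar>c(T)\<bar>\<^sup>2 = \<Sum>\<^sub>i (\<parallel>a\<^bsub>t\<^sub>i\<^esub>\<parallel>\<^sup>2 - \<bar>c(t\<^sub>i)\<bar>\<^sup>2) \<le> k (T + T\<^sup>2)\<close>. Roots lift to roots because the lift of
  \<open>u\<close> is \<open>\<iota>\<^sub>T u\<^sub>T\<close>.
\<close>

section \<open>Complex Hilbert spaces\<close>

lemma cinner_add_left: "cinner (x + y) z = cinner x z + cinner y z" for x :: "'a::chilbert_space"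
  by (metis cinner_add_right cinner_commute complex_cnj_add)

lemma cinner_scaleC_left: "cinner (scaleC c x) y = cnj c * cinner x y" for x :: "'a::chilbert_space"
  by (metis cinner_scaleC_right cinner_commute complex_cnj_mult)

lemma cinner_scaleR_right: "cinner x (r *\<^sub>R y) = r *\<^sub>R cinner x y" for x :: "'a::chilbert_space"
  by (simp add: cinner_scaleC_right scaleR_conv_of_real flip: scaleC_of_real)

lemma cinner_scaleR_left: "cinner (r *\<^sub>R x) y = r *\<^sub>R cinner x y" for x :: "'a::chilbert_space"
  by (simp add: cinner_scaleC_left scaleR_conv_of_real flip: scaleC_of_real)

lemma Re_cinner_commute: "Re (cinner x y) = Re (cinner y x)" for x :: "'a::chilbert_space"
  by (subst cinner_commute) simp

lemma cinner_eq_iff_flip: "cinner x z = cinner y z \<longleftrightarrow> cinner z x = cinner z y" for x :: "'a::chilbert_space"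
  by (metis cinner_commute)

lemma norm_add_square:
  "(norm (x + y))\<^sup>2 = (norm x)\<^sup>2 + (norm y)\<^sup>2 + 2 * Re (cinner x y)" for x :: "'a::chilbert_space"
proof -
  have "complex_of_real ((norm (x + y))\<^sup>2)
      = of_real ((norm x)\<^sup>2) + of_real ((norm y)\<^sup>2) + (cinner x y + cinner y x)"
    unfolding cinner_self[symmetric] by (simp add: cinner_add_left cinner_add_right)
  from arg_cong[OF this, of Re] show ?thesis
    by (simp add: Re_cinner_commute[of y x])
qed

lemma norm_scaleC: "norm (scaleC c x) = cmod c * norm x" for x :: "'a::chilbert_space"
proof -
  have "complex_of_real ((norm (scaleC c x))\<^sup>2) = cnj c * c * of_real ((norm x)\<^sup>2)"
    unfolding cinner_self[symmetric] by (simp add: cinner_scaleC_left cinner_scaleC_right)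
  also have "cnj c * c = of_real ((cmod c)\<^sup>2)"
    by (metis complex_norm_square mult.commute)
  finally have "(norm (scaleC c x))\<^sup>2 = (cmod c * norm x)\<^sup>2"
    unfolding of_real_mult[symmetric] of_real_eq_iff by (simp add: power_mult_distrib)
  thus ?thesis by (simp add: power2_eq_imp_eq)
qed

text \<open>For nonzero \<open>y\<close>, the square of the norm of \<open>x + scaleC c y\<close> is
  nonnegative; it is evaluated at the scalar \<open>c\<close> that minimises it.\<close>

lemma cauchy_schwarz: "cmod (cinner x y) \<le> norm x * norm y" for x :: "'a::chilbert_space"
proof (cases "norm y = 0")
  case True
  have "cinner x (scaleC 0 y) = 0" by (simp only: cinner_scaleC_right) simp
  moreover have "scaleC 0 y = y" using True by (simp add: complex_vs.scale_zero_left)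
  ultimately show ?thesis by simp
next
  case False
  define N where "N = (norm y)\<^sup>2"
  have N: "N > 0" using False by (simp add: N_def)
  define c where "c = - cinner y x / of_real N"
  have "0 \<le> (norm (x + scaleC c y))\<^sup>2" by simp
  also have "\<dots> = (norm x)\<^sup>2 + (cmod c)\<^sup>2 * N + 2 * Re (c * cinner x y)"
    by (simp add: norm_add_square norm_scaleC power_mult_distrib N_def cinner_scaleC_right)
  also have "c * cinner x y = - of_real ((cmod (cinner x y))\<^sup>2 / N)"
    using complex_norm_square[of "cinner x y"]
    by (simp add: c_def cinner_commute[of y x] mult.commute)
  also have "cmod c = cmod (cinner x y) / N"
    using N by (simp add: c_def norm_divide cinner_commute[of y x])
  finally have "0 \<le> (norm x)\<^sup>2 - (cmod (cinner x y))\<^sup>2 / N"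
    using N by (simp add: power_divide power2_eq_square)
  hence "(cmod (cinner x y))\<^sup>2 \<le> (norm x * norm y)\<^sup>2"
    using N by (simp add: field_simps N_def)
  thus ?thesis by (rule power2_le_imp_le) simp
qed

interpretation cinner: bounded_bilinear "cinner :: 'a::chilbert_space \<Rightarrow> 'a \<Rightarrow> complex"
  by (unfold_locales)
     (auto simp: cinner_add_left cinner_add_right cinner_scaleR_left cinner_scaleR_right
        intro!: exI[of _ 1] cauchy_schwarz)

lemma norm_diff_square:
  "(norm (x - y))\<^sup>2 = (norm x)\<^sup>2 + (norm y)\<^sup>2 - 2 * Re (cinner x y)" for x :: "'a::chilbert_space"
  using norm_add_square[of x "- y"] by (simp add: cinner.minus_right)

text \<open>Equality case of Cauchy-Schwarz. For the unit it will turn information about the adjoint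
  of an isometry into information about the isometry itself.\<close>

lemma eq_of_cinner_eq_1:
  fixes x :: "'a::chilbert_space"
  assumes "norm x = 1" "norm y = 1" "cinner x y = 1"
  shows "x = y"
  using norm_diff_square[of x y] assms by simp

lemma scaleC_minus_one: "scaleC (- 1) x = - x" for x :: "'a::chilbert_space"
  using complex_vs.scale_minus_left[of 1 x] by (simp add: scaleC_one)

lemma bounded_linear_scaleC: "bounded_linear (scaleC c :: 'a \<Rightarrow> 'a::chilbert_space)"
proof
  fix r :: real and x y :: 'a
  show "scaleC c (x + y) = scaleC c x + scaleC c y" by (rule scaleC_add_right)
  show "scaleC c (r *\<^sub>R x) = r *\<^sub>R scaleC c x"
    by (simp add: scaleC_scaleC mult.commute flip: scaleC_of_real)
  show "\<exists>K. \<forall>x::'a. norm (scaleC c x) \<le> norm x * K"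
    by (rule exI[of _ "cmod c"]) (simp add: norm_scaleC)
qed

section \<open>Subspaces, closed spans and density\<close>

lemmas csubspace_0 = complex_vs.subspace_0[folded csubspace_def]
lemmas csubspace_add = complex_vs.subspace_add[folded csubspace_def]
lemmas csubspace_scale = complex_vs.subspace_scale[folded csubspace_def]
lemmas csubspace_diff = complex_vs.subspace_diff[folded csubspace_def]
lemmas csubspaceI = complex_vs.subspaceI[folded csubspace_def]
lemmas csubspace_cspan = complex_vs.subspace_span[folded csubspace_def cspan_def]
lemmas cspan_base = complex_vs.span_base[folded cspan_def]
lemmas cspan_minimal = complex_vs.span_minimal[folded csubspace_def cspan_def]

lemma csubspace_scaleR: "csubspace D \<Longrightarrow> x \<in> D \<Longrightarrow> r *\<^sub>R x \<in> D"
  using csubspace_scale[of D x "of_real r"] by (simp add: scaleC_of_real)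

lemma csubspace_closure:
  assumes "csubspace D"
  shows "csubspace (closure D)"
proof (rule csubspaceI)
  show "0 \<in> closure D" using csubspace_0[OF assms] closure_subset by blast
next
  fix x y assume "x \<in> closure D" "y \<in> closure D"
  then obtain X Y where "\<forall>n. X n \<in> D" "X \<longlonglongrightarrow> x" "\<forall>n. Y n \<in> D" "Y \<longlonglongrightarrow> y"
    unfolding closure_sequential by blast
  thus "x + y \<in> closure D"
    unfolding closure_sequential
    by (intro exI[of _ "\<lambda>n. X n + Y n"]) (auto intro: tendsto_add csubspace_add[OF assms])
next
  fix c x assume "x \<in> closure D"
  then obtain X where "\<forall>n. X n \<in> D" "X \<longlonglongrightarrow> x"
    unfolding closure_sequential by blast
  thus "scaleC c x \<in> closure D"
    unfolding closure_sequential
    by (intro exI[of _ "\<lambda>n. scaleC c (X n)"])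
       (auto intro: bounded_linear.tendsto[OF bounded_linear_scaleC] csubspace_scale[OF assms])
qed

text \<open>Membership in the closed span is carried along with \<open>P\<close>, so that maps known
  to be linear only on that closed subspace can be used in the cases. One limit suffices, as every
  point of the closure is the limit of a sequence from the span.\<close>

lemma closure_cspan_induct [consumes 1, case_names base zero add scale limit]:
  assumes "x \<in> closure (cspan S)"
    and base: "\<And>x. x \<in> S \<Longrightarrow> P x"
    and zero: "P 0"
    and add: "\<And>x y. \<lbrakk>x \<in> closure (cspan S); y \<in> closure (cspan S); P x; P y\<rbrakk> \<Longrightarrow> P (x + y)"
    and scale: "\<And>c x. \<lbrakk>x \<in> closure (cspan S); P x\<rbrakk> \<Longrightarrow> P (scaleC c x)"
    and limit: "\<And>X x. \<lbrakk>\<forall>n. X n \<in> closure (cspan S); x \<in> closure (cspan S); \<forall>n. P (X n); X \<longlonglongrightarrow> x\<rbrakk>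
      \<Longrightarrow> P x"
  shows "P x"
proof -
  have "y \<in> closure (cspan S) \<and> P y" if "y \<in> cspan S" for y
  proof -
    have "cspan S \<subseteq> {y. y \<in> closure (cspan S) \<and> P y}"
    proof (rule cspan_minimal)
      show "S \<subseteq> {y. y \<in> closure (cspan S) \<and> P y}"
        using base closure_subset cspan_base by blast
      show "csubspace {y. y \<in> closure (cspan S) \<and> P y}"
        using csubspace_closure[OF csubspace_cspan[of S]]
        by (intro csubspaceI) (auto intro: zero add scale csubspace_0 csubspace_add csubspace_scale)
    qed
    thus ?thesis using that by blast
  qed
  moreover obtain X where "\<forall>n. X n \<in> cspan S" "X \<longlonglongrightarrow> x"
    using assms(1) unfolding closure_sequential by blast
  ultimately show ?thesis using limit assms(1) by metis
qed

lemma cinner_eq_closure: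
  fixes x :: "'a::chilbert_space"
  assumes "\<And>z. z \<in> D \<Longrightarrow> cinner x z = cinner y z" and "z \<in> closure D"
  shows "cinner x z = cinner y z"
proof -
  obtain Z where Z: "\<forall>n. Z n \<in> D" "Z \<longlonglongrightarrow> z"
    using assms(2) unfolding closure_sequential by blast
  have "(\<lambda>n. cinner x (Z n)) \<longlonglongrightarrow> cinner x z" "(\<lambda>n. cinner y (Z n)) \<longlonglongrightarrow> cinner y z"
    using Z(2) by (auto intro: cinner.tendsto)
  moreover have "(\<lambda>n. cinner x (Z n)) = (\<lambda>n. cinner y (Z n))" using assms(1) Z(1) by auto
  ultimately show ?thesis using LIMSEQ_unique by metis
qed

lemma cinner_eqI:
  fixes x :: "'a::chilbert_space"
  assumes "csubspace H" "x \<in> H" "y \<in> H" and "\<And>z. z \<in> H \<Longrightarrow> cinner x z = cinner y z"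
  shows "x = y"
proof -
  have "cinner (x - y) (x - y) = 0"
    using assms csubspace_diff[OF assms(1-3)] by (simp add: cinner.diff_left)
  thus ?thesis by (simp add: cinner_self)
qed

text \<open>The vector \<open>z\<close> is the limit of a minimising sequence of
  \<open>x \<mapsto> \<parallel>x\<parallel>\<^sup>2 - 2 Re (\<phi> x)\<close> on \<open>D\<close>.\<close>

lemma riesz_representation:
  fixes D :: "'a::chilbert_space set" and \<phi> :: "'a \<Rightarrow> complex"
  assumes D: "csubspace D"
    and add: "\<And>x y. x \<in> D \<Longrightarrow> y \<in> D \<Longrightarrow> \<phi> (x + y) = \<phi> x + \<phi> y"
    and scale: "\<And>c x. x \<in> D \<Longrightarrow> \<phi> (scaleC c x) = c * \<phi> x"
    and bound: "\<And>x. x \<in> D \<Longrightarrow> cmod (\<phi> x) \<le> K * norm x"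
    and "0 \<le> K"
  shows "\<exists>z\<in>closure D. (\<forall>x\<in>D. cinner z x = \<phi> x) \<and> norm z \<le> K"
proof -
  define q where "q x = (norm x)\<^sup>2 - 2 * Re (\<phi> x)" for x
  have q_lower: "- K\<^sup>2 \<le> q x" if "x \<in> D" for x
  proof -
    have "Re (\<phi> x) \<le> K * norm x"
      using bound[OF that] complex_Re_le_cmod[of "\<phi> x"] by linarith
    moreover have "0 \<le> (norm x - K)\<^sup>2" by simp
    ultimately show ?thesis by (simp add: q_def power2_eq_square algebra_simps)
  qed
  define m where "m = Inf (q ` D)"
  have ne: "q ` D \<noteq> {}" using csubspace_0[OF D] by auto
  have bdd: "bdd_below (q ` D)" using q_lower by (auto intro!: bdd_belowI)
  have m_le: "m \<le> q x" if "x \<in> D" for x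
    unfolding m_def using that bdd by (intro cInf_lower) auto
  have "\<exists>x\<in>D. q x < m + 1 / Suc n" for n
    using cInf_lessD[OF ne, of "m + 1 / Suc n"] unfolding m_def by auto
  then obtain X where X: "\<And>n. X n \<in> D" and qX: "\<And>n. q (X n) < m + 1 / Suc n" by metis
  \<comment> \<open>Parallelogram law: the midpoint \<open>w\<close> lies in \<open>D\<close>, so
    \<open>m \<le> q w\<close>, and \<open>q\<close> is a norm square minus a real-linear
    term.\<close>
  have dist_sq: "(norm (x - y))\<^sup>2 \<le> 2 * (q x - m) + 2 * (q y - m)" if "x \<in> D" "y \<in> D" for x y
  proof -
    define w where "w = (1/2) *\<^sub>R (x + y)"
    have wD: "w \<in> D" unfolding w_def using that by (intro csubspace_scaleR csubspace_add D)
    have "\<phi> w = of_real (1/2) * (\<phi> x + \<phi> y)"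
      using scale[OF csubspace_add[OF D that], of "of_real (1/2)"]
      unfolding w_def scaleC_of_real add[OF that] .
    hence "Re (\<phi> w) = (Re (\<phi> x) + Re (\<phi> y)) / 2"
      by (simp only: Re_complex_of_real Im_complex_of_real times_complex.simps) simp
    moreover have "(norm w)\<^sup>2 = (norm (x + y))\<^sup>2 / 4"
      by (simp add: w_def power_divide)
    ultimately have "(norm (x - y))\<^sup>2 = 2 * q x + 2 * q y - 4 * q w"
      by (simp add: q_def norm_add_square norm_diff_square)
    thus ?thesis using m_le[OF wD] by simp
  qed
  have "Cauchy X"
  proof (rule metric_CauchyI)
    fix e :: real assume "0 < e"
    then obtain N where N: "1 / Suc N < e\<^sup>2 / 4"
      using nat_approx_posE[of "e\<^sup>2 / 4"] by auto
    have "dist (X i) (X j) < e" if "i \<ge> N" "j \<ge> N" for i j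
    proof -
      have small: "q (X i) - m < e\<^sup>2 / 4" if "i \<ge> N" for i
      proof -
        have "1 / Suc i \<le> 1 / Suc N" using that by (simp add: frac_le)
        thus ?thesis using qX[of i] N by linarith
      qed
      have "(norm (X i - X j))\<^sup>2 < e\<^sup>2"
        using dist_sq[OF X X, of i j] small[of i] small[of j] that by simp
      thus ?thesis using \<open>0 < e\<close> by (simp add: dist_norm power2_less_imp_less)
    qed
    thus "\<exists>M. \<forall>i\<ge>M. \<forall>j\<ge>M. dist (X i) (X j) < e" by blast
  qed
  then obtain z where z: "X \<longlonglongrightarrow> z" using Cauchy_convergent convergent_def by blast
  \<comment> \<open>First variation: \<open>q (X n + t *\<^sub>R x)\<close> is at least
    \<open>m\<close>, while \<open>q (X n)\<close> exceeds \<open>m\<close> by less than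
    \<open>1 / Suc n\<close>. In the limit a quadratic polynomial in \<open>t\<close> remains that
    is nowhere negative.\<close>
  have Re_eq: "Re (cinner z x) = Re (\<phi> x)" if x: "x \<in> D" for x
  proof -
    have var: "0 \<le> 2 * t * (Re (cinner z x) - Re (\<phi> x)) + t\<^sup>2 * (norm x)\<^sup>2" for t :: real
    proof (rule LIMSEQ_le)
      show "(\<lambda>n. - (1 / real (Suc n))) \<longlonglongrightarrow> 0"
        using tendsto_minus[OF LIMSEQ_inverse_real_of_nat] by (simp add: inverse_eq_divide)
      show "(\<lambda>n. 2 * t * (Re (cinner (X n) x) - Re (\<phi> x)) + t\<^sup>2 * (norm x)\<^sup>2)
          \<longlonglongrightarrow> 2 * t * (Re (cinner z x) - Re (\<phi> x)) + t\<^sup>2 * (norm x)\<^sup>2"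
        by (intro tendsto_intros cinner.tendsto z)
      have "- (1 / Suc n) \<le> 2 * t * (Re (cinner (X n) x) - Re (\<phi> x)) + t\<^sup>2 * (norm x)\<^sup>2" for n
      proof -
        have tx: "t *\<^sub>R x \<in> D" by (rule csubspace_scaleR[OF D x])
        have "m \<le> q (X n + t *\<^sub>R x)" by (rule m_le[OF csubspace_add[OF D X tx]])
        also have "\<dots> = q (X n) + (2 * t * (Re (cinner (X n) x) - Re (\<phi> x)) + t\<^sup>2 * (norm x)\<^sup>2)"
          using scale[OF x, of "of_real t"]
          by (simp add: q_def norm_add_square add[OF X tx] scaleC_of_real cinner.scaleR_right
              power_mult_distrib algebra_simps)
        finally show ?thesis using qX[of n] by linarith
      qed
      thus "\<exists>N. \<forall>n\<ge>N. - (1 / real (Suc n))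
          \<le> 2 * t * (Re (cinner (X n) x) - Re (\<phi> x)) + t\<^sup>2 * (norm x)\<^sup>2" by blast
    qed
    define d where "d = Re (cinner z x) - Re (\<phi> x)"
    \<comment> \<open>The quadratic is tested at \<open>t = - d / M\<close>; the summand 1 keeps
      \<open>M\<close> positive when \<open>x = 0\<close>.\<close>
    define M where "M = (norm x)\<^sup>2 + 1"
    have M: "M > 0" by (simp add: M_def add_nonneg_pos)
    have "0 \<le> 2 * (- d / M) * d + (- d / M)\<^sup>2 * (norm x)\<^sup>2" using var[of "- d / M"] by (simp add: d_def)
    also have "\<dots> \<le> 2 * (- d / M) * d + (- d / M)\<^sup>2 * M"
      by (intro add_left_mono mult_left_mono) (auto simp: M_def)
    also have "\<dots> = - d\<^sup>2 / M" using M by (simp add: field_simps power2_eq_square)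
    finally have "d\<^sup>2 / M \<le> 0" by simp
    hence "d\<^sup>2 \<le> 0" using M by (simp add: divide_le_0_iff)
    thus ?thesis by (simp add: d_def)
  qed
  have eq: "cinner z x = \<phi> x" if x: "x \<in> D" for x
  proof (rule complex_eqI)
    show "Re (cinner z x) = Re (\<phi> x)" by (rule Re_eq[OF x])
    show "Im (cinner z x) = Im (\<phi> x)"
      using Re_eq[OF csubspace_scale[OF D x, of \<i>]] scale[OF x, of \<i>]
      by (simp add: cinner_scaleC_right)
  qed
  \<comment> \<open>Since \<open>z\<close> may lie outside \<open>D\<close>, the bound on the
    functional is applied to the \<open>X n\<close> and passed to the limit.\<close>
  have "cmod (cinner z z) \<le> K * norm z"
  proof (rule LIMSEQ_le)
    show "(\<lambda>n. cmod (cinner z (X n))) \<longlonglongrightarrow> cmod (cinner z z)"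
      by (intro tendsto_norm cinner.tendsto z tendsto_const)
    show "(\<lambda>n. K * norm (X n)) \<longlonglongrightarrow> K * norm z" by (intro tendsto_intros z)
    show "\<exists>N. \<forall>n\<ge>N. cmod (cinner z (X n)) \<le> K * norm (X n)" using eq bound X by auto
  qed
  hence "norm z * norm z \<le> K * norm z" by (simp add: cinner_self norm_mult power2_eq_square)
  hence "norm z \<le> K" using \<open>0 \<le> K\<close>
    by (cases "z = 0") (auto simp: mult_le_cancel_right)
  moreover have "z \<in> closure D" unfolding closure_sequential using X z by blast
  ultimately show ?thesis using eq by blast
qed

section \<open>Operators on subspaces: continuity, isometries, adjoints\<close>

lemma clinear_on_0: "clinear_on H f \<Longrightarrow> csubspace H \<Longrightarrow> f 0 = 0"
  unfolding clinear_on_def by (metis complex_vs.scale_zero_left csubspace_0)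

lemma clinear_on_diff:
  assumes "clinear_on H f" "csubspace H" "x \<in> H" "y \<in> H"
  shows "f (x - y) = f x - f y"
proof -
  have "f (x + scaleC (- 1) y) = f x + scaleC (- 1) (f y)"
    using assms csubspace_scale unfolding clinear_on_def by metis
  thus ?thesis by (simp add: scaleC_minus_one)
qed

lemma bounded_clinear_on_tendsto:
  assumes f: "bounded_clinear_on H f" and H: "csubspace H"
    and X: "\<forall>n. X n \<in> H" "x \<in> H" "X \<longlonglongrightarrow> x"
  shows "(\<lambda>n. f (X n)) \<longlonglongrightarrow> f x"
proof -
  obtain K where lin: "clinear_on H f" and K: "\<And>x. x \<in> H \<Longrightarrow> norm (f x) \<le> K * norm x"
    using f unfolding bounded_clinear_on_def by blast
  have "(\<lambda>n. f (X n) - f x) \<longlonglongrightarrow> 0"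
  proof (rule Lim_null_comparison)
    show "\<forall>\<^sub>F n in sequentially. norm (f (X n) - f x) \<le> K * norm (X n - x)"
      using K[OF csubspace_diff[OF H]] X by (simp add: clinear_on_diff[OF lin H])
    have "(\<lambda>n. K * norm (X n - x)) \<longlonglongrightarrow> K * norm (x - x)" by (intro tendsto_intros X)
    thus "(\<lambda>n. K * norm (X n - x)) \<longlonglongrightarrow> 0" by simp
  qed
  thus ?thesis by (rule LIM_zero_cancel)
qed

lemma isometry_on_bounded: "isometry_on H K V \<Longrightarrow> bounded_clinear_on H V"
  unfolding isometry_on_def bounded_clinear_on_def by (metis mult_1 order_refl)

lemma isometry_on_id: "isometry_on H H id"
  by (simp add: isometry_on_def clinear_on_def)

lemma isometry_on_comp:
  "isometry_on H K V \<Longrightarrow> isometry_on K L W \<Longrightarrow> isometry_on H L (W \<circ> V)"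
  unfolding isometry_on_def clinear_on_def image_subset_iff by auto

text \<open>Polarisation: the norms of sums give the real part, and replacing \<open>y\<close> by
  \<open>scaleC \<i> y\<close> gives the imaginary part.\<close>

lemma isometry_on_cinner:
  assumes V: "isometry_on H K V" and H: "csubspace H" and x: "x \<in> H" "y \<in> H"
  shows "cinner (V x) (V y) = cinner x y"
proof -
  have Re: "Re (cinner (V x) (V y)) = Re (cinner x y)" if "x \<in> H" "y \<in> H" for x y
  proof -
    have "norm (V x + V y) = norm (x + y)" "norm (V x) = norm x" "norm (V y) = norm y"
      using V that csubspace_add[OF H that] unfolding isometry_on_def clinear_on_def by metis+
    thus ?thesis using norm_add_square[of x y] norm_add_square[of "V x" "V y"] by simp
  qed
  show ?thesis
  proof (rule complex_eqI)
    show "Re (cinner (V x) (V y)) = Re (cinner x y)" by (rule Re[OF x])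
    have "V (scaleC \<i> y) = scaleC \<i> (V y)" using V x unfolding isometry_on_def clinear_on_def by blast
    thus "Im (cinner (V x) (V y)) = Im (cinner x y)"
      using Re[OF x(1) csubspace_scale[OF H x(2), of \<i>]] by (simp add: cinner_scaleC_right)
  qed
qed

lemma adjoint_on_eqI:
  assumes "csubspace H" "z \<in> H" "\<And>x. x \<in> H \<Longrightarrow> cinner z x = cinner y (V x)"
  shows "adjoint_on H V y = z"
  unfolding adjoint_on_def
proof (rule the_equality)
  show "z \<in> H \<and> (\<forall>x\<in>H. cinner z x = cinner y (V x))" using assms by blast
  fix w assume "w \<in> H \<and> (\<forall>x\<in>H. cinner w x = cinner y (V x))"
  thus "w = z" using assms cinner_eqI[of H w z] by simp
qed

text \<open>The functional \<open>\<lambda>x. cinner y (V x)\<close> is bounded by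
  \<open>norm y\<close>. Its Riesz vector is what the description in \<open>adjoint_on\<close>
  denotes, and the norm bound of that vector makes the adjoint contractive.\<close>

lemma adjoint_on_isometry:
  assumes H: "hilbert_subspace H" and V: "isometry_on H K V"
  shows "adjoint_on H V y \<in> H"
    and "x \<in> H \<Longrightarrow> cinner (adjoint_on H V y) x = cinner y (V x)"
    and "norm (adjoint_on H V y) \<le> norm y"
proof -
  have sub: "csubspace H" and "closed H" using H unfolding hilbert_subspace_def by auto
  have add: "cinner y (V (v + w)) = cinner y (V v) + cinner y (V w)" if "v \<in> H" "w \<in> H" for v w
    using V that unfolding isometry_on_def clinear_on_def by (simp add: cinner_add_right)
  have scale: "cinner y (V (scaleC c v)) = c * cinner y (V v)" if "v \<in> H" for c v
    using V that unfolding isometry_on_def clinear_on_def by (simp add: cinner_scaleC_right)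
  have bound: "cmod (cinner y (V v)) \<le> norm y * norm v" if "v \<in> H" for v
    using cauchy_schwarz[of y "V v"] V that unfolding isometry_on_def by simp
  obtain z where z: "z \<in> closure H" "\<And>v. v \<in> H \<Longrightarrow> cinner z v = cinner y (V v)"
      "norm z \<le> norm y"
    using riesz_representation[of H "\<lambda>v. cinner y (V v)", OF sub add scale bound norm_ge_zero]
    by blast
  have zH: "z \<in> H" using z(1) \<open>closed H\<close> by (simp add: closure_closed)
  have eq: "adjoint_on H V y = z" by (rule adjoint_on_eqI[OF sub zH z(2)])
  show "adjoint_on H V y \<in> H" using eq zH by simp
  show "cinner (adjoint_on H V y) x = cinner y (V x)" if "x \<in> H" using eq z(2) that by simp
  show "norm (adjoint_on H V y) \<le> norm y" using eq z(3) by auto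
qed

text \<open>The image of \<open>x\<close> is the vector \<open>y\<close> with \<open>\<langle>q i, y\<rangle> = \<langle>p i, x\<rangle>\<close> for all \<open>i\<close>; the statement that it
  exists is strengthened so as to pass to sums and limits in \<open>x\<close>.\<close>

lemma isometry_extension:
  fixes p :: "'i \<Rightarrow> 'a::chilbert_space" and q :: "'i \<Rightarrow> 'b::chilbert_space"
  assumes pq: "\<And>i j. i \<in> I \<Longrightarrow> j \<in> I \<Longrightarrow> cinner (p i) (p j) = cinner (q i) (q j)"
  shows "\<exists>f. isometry_on (closure (cspan (p ` I))) (closure (cspan (q ` I))) f \<and> (\<forall>i\<in>I. f (p i) = q i)"
proof -
  define H where "H = closure (cspan (p ` I))"
  define K where "K = closure (cspan (q ` I))"
  have H: "csubspace H" unfolding H_def by (rule csubspace_closure[OF csubspace_cspan])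
  have K: "csubspace K" unfolding K_def by (rule csubspace_closure[OF csubspace_cspan])
  \<comment> \<open>\<open>G\<close> will be the graph of the isometry on \<open>H\<close>:
    \<open>y\<close> has the same inner products with the \<open>q i\<close> as \<open>x\<close> has
    with the \<open>p i\<close>.\<close>
  define G where "G x y \<longleftrightarrow> x \<in> H \<and> y \<in> K \<and> (\<forall>i\<in>I. cinner (q i) y = cinner (p i) x)" for x y
  have pH: "p i \<in> H" if "i \<in> I" for i
    unfolding H_def using that by (intro subsetD[OF closure_subset] cspan_base imageI)
  have qK: "q i \<in> K" if "i \<in> I" for i
    unfolding K_def using that by (intro subsetD[OF closure_subset] cspan_base imageI)
  have G_base: "G (p i) (q i)" if "i \<in> I" for i
    using that pq pH qK by (simp add: G_def)
  have G_add: "G (x + x') (y + y')" if "G x y" "G x' y'" for x y x' y'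
    using that by (simp add: G_def cinner_add_right csubspace_add[OF H] csubspace_add[OF K])
  have G_diff: "G (x - x') (y - y')" if "G x y" "G x' y'" for x y x' y'
    using that by (simp add: G_def cinner.diff_right csubspace_diff[OF H] csubspace_diff[OF K])
  have G_scale: "G (scaleC c x) (scaleC c y)" if "G x y" for c x y
    using that by (simp add: G_def cinner_scaleC_right csubspace_scale[OF H] csubspace_scale[OF K])
  have ex: "\<exists>y. G x y \<and> (\<forall>x' y'. G x' y' \<longrightarrow> cinner y y' = cinner x x')" if "x \<in> H" for x
    using that unfolding H_def
  proof (induction x rule: closure_cspan_induct)
    case (base x)
    then obtain i where "i \<in> I" "x = p i" by blast
    thus ?case using G_base by (intro exI[of _ "q i"]) (auto simp: G_def)
  next
    case zero
    show ?case
      using csubspace_0[OF H] csubspace_0[OF K]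
      by (intro exI[of _ 0]) (simp add: G_def cinner.zero_left cinner.zero_right)
  next
    case (add x y)
    then obtain x' y' where "G x x'" "G y y'"
      "\<forall>v w. G v w \<longrightarrow> cinner x' w = cinner x v" "\<forall>v w. G v w \<longrightarrow> cinner y' w = cinner y v" by blast
    thus ?case by (intro exI[of _ "x' + y'"]) (auto simp: cinner_add_left intro: G_add)
  next
    case (scale c x)
    then obtain x' where "G x x'" "\<forall>v w. G v w \<longrightarrow> cinner x' w = cinner x v" by blast
    thus ?case by (intro exI[of _ "scaleC c x'"]) (auto simp: cinner_scaleC_left intro: G_scale)
  next
    case (limit X x)
    then obtain Y where GY: "\<And>n. G (X n) (Y n)"
      and Y: "\<And>n v w. G v w \<Longrightarrow> cinner (Y n) w = cinner (X n) v" by metis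
    \<comment> \<open>\<open>G\<close> is closed under differences, so \<open>Y i - Y j\<close> may
      be tested against itself; hence \<open>Y\<close> is Cauchy because \<open>X\<close>
      is.\<close>
    have nrm: "norm (Y i - Y j) = norm (X i - X j)" for i j
    proof -
      have "cinner (Y i - Y j) (Y i - Y j) = cinner (X i - X j) (X i - X j)"
        using Y[OF G_diff[OF GY GY], of i i j] Y[OF G_diff[OF GY GY], of j i j]
        by (simp add: cinner.diff_left)
      hence "(norm (Y i - Y j))\<^sup>2 = (norm (X i - X j))\<^sup>2"
        unfolding cinner_self of_real_eq_iff .
      thus ?thesis by (simp add: power2_eq_imp_eq)
    qed
    have "Cauchy X" using limit.hyps(3) by (rule LIMSEQ_imp_Cauchy)
    hence "Cauchy Y" unfolding Cauchy_def dist_norm nrm .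
    then obtain y where y: "Y \<longlonglongrightarrow> y" using Cauchy_convergent convergent_def by blast
    have "y \<in> K"
      using closed_sequentially[of K Y y] GY y unfolding G_def by (simp add: K_def)
    moreover have "cinner (q i) y = cinner (p i) x" if "i \<in> I" for i
    proof (rule LIMSEQ_unique)
      show "(\<lambda>n. cinner (q i) (Y n)) \<longlonglongrightarrow> cinner (q i) y" by (intro cinner.tendsto tendsto_const y)
      show "(\<lambda>n. cinner (q i) (Y n)) \<longlonglongrightarrow> cinner (p i) x"
        using cinner.tendsto[OF tendsto_const limit.hyps(3), of "p i"] GY that by (simp add: G_def)
    qed
    moreover have "cinner y w = cinner x v" if "G v w" for v w
    proof (rule LIMSEQ_unique)
      show "(\<lambda>n. cinner (Y n) w) \<longlonglongrightarrow> cinner y w" by (intro cinner.tendsto tendsto_const y)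
      show "(\<lambda>n. cinner (Y n) w) \<longlonglongrightarrow> cinner x v"
        using cinner.tendsto[OF limit.hyps(3) tendsto_const, of v] Y[OF that] by simp
    qed
    ultimately show ?case using limit.hyps(2) by (auto simp: G_def H_def)
  qed
  then obtain f where Gf: "\<And>x. x \<in> H \<Longrightarrow> G x (f x)"
    and f: "\<And>x v w. x \<in> H \<Longrightarrow> G v w \<Longrightarrow> cinner (f x) w = cinner x v" by metis
  \<comment> \<open>Uniqueness: \<open>f x - y\<close> lies in \<open>K\<close> and is orthogonal to
    every \<open>q i\<close>, hence to \<open>K\<close>. Linearity of \<open>f\<close> then follows
    from the closure properties of \<open>G\<close>.\<close>
  have f_eq: "f x = y" if "G x y" for x y
  proof -
    have xH: "x \<in> H" using that by (simp add: G_def)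
    have "cinner (q i) (f x - y) = cinner (q i) 0" if "i \<in> I" for i
      using \<open>G x y\<close> Gf[OF xH] that by (simp add: G_def cinner.diff_right cinner.zero_right)
    hence "q ` I \<subseteq> {w. cinner (f x - y) w = 0}"
      using cinner_commute[of "f x - y"] by (auto simp: cinner.zero_right)
    moreover have "csubspace {w. cinner (f x - y) w = 0}"
      by (intro csubspaceI) (auto simp: cinner_add_right cinner_scaleC_right cinner.zero_right)
    ultimately have "cspan (q ` I) \<subseteq> {w. cinner (f x - y) w = 0}" by (rule cspan_minimal)
    hence "cinner (f x - y) w = cinner 0 w" if "w \<in> closure (cspan (q ` I))" for w
      using that by (intro cinner_eq_closure[OF _ that]) (auto simp: cinner.zero_left)
    hence "f x - y = 0"
      using cinner_eqI[OF K, of "f x - y" 0] G_diff[OF Gf[OF xH] that] csubspace_0[OF K]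
      unfolding G_def K_def by blast
    thus ?thesis by simp
  qed
  have "isometry_on H K f"
    unfolding isometry_on_def clinear_on_def
  proof (intro conjI ballI allI)
    fix x assume x: "x \<in> H"
    show "f (x + y) = f x + f y" if "y \<in> H" for y by (intro f_eq G_add Gf x that)
    show "f (scaleC c x) = scaleC c (f x)" for c by (intro f_eq G_scale Gf x)
    show "norm (f x) = norm x"
      using f[OF x Gf[OF x]] unfolding cinner_self of_real_eq_iff by (simp add: power2_eq_imp_eq)
  qed (use Gf in \<open>auto simp: G_def\<close>)
  moreover have "f (p i) = q i" if "i \<in> I" for i using f_eq[OF G_base[OF that]] .
  ultimately show ?thesis unfolding H_def K_def by blast
qed

section \<open>Tensor products\<close>

lemma hilbert_tensorD:
  assumes "hilbert_tensor H K \<tau> T"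
  shows "hilbert_subspace H" "hilbert_subspace K" "hilbert_subspace T"
    and "\<lbrakk>x \<in> H; y \<in> K; y' \<in> K\<rbrakk> \<Longrightarrow> \<tau> x (y + y') = \<tau> x y + \<tau> x y'"
    and "\<lbrakk>x \<in> H; x' \<in> H; y \<in> K\<rbrakk> \<Longrightarrow> \<tau> (x + x') y = \<tau> x y + \<tau> x' y"
    and "\<lbrakk>x \<in> H; x' \<in> H; y \<in> K; y' \<in> K\<rbrakk> \<Longrightarrow> cinner (\<tau> x y) (\<tau> x' y') = cinner x x' * cinner y y'"
    and "T = closure (cspan {\<tau> x y | x y. x \<in> H \<and> y \<in> K})"
  using assms unfolding hilbert_tensor_def clinear_on_def by blast+

lemma hilbert_tensor_in:
  assumes "hilbert_tensor H K \<tau> T" "x \<in> H" "y \<in> K"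
  shows "\<tau> x y \<in> T"
  unfolding hilbert_tensorD(7)[OF assms(1)]
  using assms(2,3) by (intro subsetD[OF closure_subset] cspan_base) blast

lemma norm_hilbert_tensor:
  assumes "hilbert_tensor H K \<tau> T" "x \<in> H" "y \<in> K"
  shows "norm (\<tau> x y) = norm x * norm y"
proof -
  have "complex_of_real ((norm (\<tau> x y))\<^sup>2) = of_real ((norm x * norm y)\<^sup>2)"
    using hilbert_tensorD(6)[OF assms(1) assms(2) assms(2) assms(3) assms(3)]
    unfolding cinner_self by (simp add: power_mult_distrib)
  thus ?thesis unfolding of_real_eq_iff by (simp add: power2_eq_imp_eq)
qed

text \<open>The vectors \<open>\<tau> (A x) (V y)\<close> have the same mutual inner products as the
  simple tensors of the source, so the assignment extends to an isometry. Boundedness and density of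
  the span of simple tensors make the extension unique, so the description in
  \<open>tensor_op\<close> denotes it.\<close>

lemma tensor_op_isometry:
  fixes E :: "'a::chilbert_space tensor_system" and V :: "'a \<Rightarrow> 'b::chilbert_space"
  assumes src: "hilbert_tensor (sp E r) (sp E s) (ten E r s) (sp E (r @ s))"
    and tgt: "hilbert_tensor H K \<tau> T"
    and A: "isometry_on (sp E r) H A" and V: "isometry_on (sp E s) K V"
  shows "isometry_on (sp E (r @ s)) T (tensor_op E r s \<tau> A V)"
    and "\<lbrakk>x \<in> sp E r; y \<in> sp E s\<rbrakk> \<Longrightarrow> tensor_op E r s \<tau> A V (ten E r s x y) = \<tau> (A x) (V y)"
proof -
  define p where "p = (\<lambda>(x, y). ten E r s x y)"
  define q where "q = (\<lambda>(x, y). \<tau> (A x) (V y))"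
  define I where "I = sp E r \<times> sp E s"
  let ?S = "sp E (r @ s)"
  have S: "csubspace ?S" and sr: "csubspace (sp E r)" and ss: "csubspace (sp E s)"
    and T: "csubspace T" "closed T"
    using hilbert_tensorD(1-3)[OF src] hilbert_tensorD(3)[OF tgt] by (simp_all add: hilbert_subspace_def)
  have AH: "A x \<in> H" if "x \<in> sp E r" for x using A that by (auto simp: isometry_on_def)
  have VK: "V y \<in> K" if "y \<in> sp E s" for y using V that by (auto simp: isometry_on_def)
  have pI: "{ten E r s x y | x y. x \<in> sp E r \<and> y \<in> sp E s} = p ` I"
    by (auto simp: p_def I_def image_iff)
  have "cinner (p i) (p j) = cinner (q i) (q j)" if "i \<in> I" "j \<in> I" for i j
    using that
    by (auto simp: I_def p_def q_def hilbert_tensorD(6)[OF src] hilbert_tensorD(6)[OF tgt] AH VK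
        isometry_on_cinner[OF A sr] isometry_on_cinner[OF V ss])
  then obtain f where f: "isometry_on (closure (cspan (p ` I))) (closure (cspan (q ` I))) f"
    and fp: "\<And>i. i \<in> I \<Longrightarrow> f (p i) = q i"
    using isometry_extension[of I p q] by blast
  have Sp: "closure (cspan (p ` I)) = ?S" using hilbert_tensorD(7)[OF src] pI by simp
  have "closure (cspan (q ` I)) \<subseteq> T"
    using T by (intro closure_minimal cspan_minimal)
      (auto simp: I_def q_def intro!: hilbert_tensor_in[OF tgt] AH VK)
  with f have fT: "isometry_on ?S T f" unfolding Sp isometry_on_def by auto
  \<comment> \<open>The description asks for an extensional function, so the values of
    \<open>f\<close> outside the tensor product are discarded.\<close>
  define g where "g = restrict f ?S"
  have g: "isometry_on ?S T g"
    using fT csubspace_add[OF S] csubspace_scale[OF S]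
    unfolding isometry_on_def clinear_on_def g_def by auto
  have gp: "g (ten E r s x y) = \<tau> (A x) (V y)" if "x \<in> sp E r" "y \<in> sp E s" for x y
    using fp[of "(x, y)"] that hilbert_tensor_in[OF src that] by (simp add: I_def p_def q_def g_def)
  have "tensor_op E r s \<tau> A V = g"
    unfolding tensor_op_def
  proof (rule the_equality)
    show "g \<in> extensional ?S \<and> bounded_clinear_on ?S g \<and>
        (\<forall>x\<in>sp E r. \<forall>y\<in>sp E s. g (ten E r s x y) = \<tau> (A x) (V y))"
      using gp isometry_on_bounded[OF g] by (auto simp: g_def)
  next
    fix h assume h: "h \<in> extensional ?S \<and> bounded_clinear_on ?S h \<and>
        (\<forall>x\<in>sp E r. \<forall>y\<in>sp E s. h (ten E r s x y) = \<tau> (A x) (V y))"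
    hence hb: "bounded_clinear_on ?S h" and hl: "clinear_on ?S h" and gl: "clinear_on ?S g"
      using g by (auto simp: bounded_clinear_on_def isometry_on_def)
    have "h z = g z" if "z \<in> closure (cspan (p ` I))" for z
      using that
    proof (induction z rule: closure_cspan_induct)
      case (base z)
      thus ?case using h gp by (auto simp: I_def p_def)
    next
      case zero
      show ?case using clinear_on_0[OF hl S] clinear_on_0[OF gl S] by simp
    next
      case (add y z)
      thus ?case using hl gl unfolding Sp clinear_on_def by simp
    next
      case (scale c y)
      thus ?case using hl gl unfolding Sp clinear_on_def by simp
    next
      case (limit X z)
      have "(\<lambda>n. h (X n)) \<longlonglongrightarrow> h z" "(\<lambda>n. g (X n)) \<longlonglongrightarrow> g z"
        by (intro bounded_clinear_on_tendsto[OF hb S]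
              bounded_clinear_on_tendsto[OF isometry_on_bounded[OF g] S] limit.hyps[unfolded Sp])+
      thus ?case unfolding limit.IH[rule_format] by (rule LIMSEQ_unique)
    qed
    moreover have "g \<in> extensional ?S" unfolding g_def by (rule restrict_extensional)
    ultimately show "h = g" unfolding Sp using h extensionalityI[of h ?S g] by blast
  qed
  thus "isometry_on ?S T (tensor_op E r s \<tau> A V)"
    and "\<lbrakk>x \<in> sp E r; y \<in> sp E s\<rbrakk> \<Longrightarrow> tensor_op E r s \<tau> A V (ten E r s x y) = \<tau> (A x) (V y)"
    using g gp by simp_all
qed

text \<open>\<open>(A \<otimes> V)\<^sup>* (p \<otimes> q) = A\<^sup>* p \<otimes> V\<^sup>* q\<close>, with \<open>p' = A\<^sup>* p\<close> and \<open>q' = V\<^sup>* q\<close>.\<close>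

lemma tensor_op_cinner:
  fixes E :: "'a::chilbert_space tensor_system" and V :: "'a \<Rightarrow> 'b::chilbert_space"
  assumes src: "hilbert_tensor (sp E r) (sp E s) (ten E r s) (sp E (r @ s))"
    and tgt: "hilbert_tensor H K \<tau> T"
    and A: "isometry_on (sp E r) H A" and V: "isometry_on (sp E s) K V"
    and p: "p \<in> H" "p' \<in> sp E r" "\<And>x. x \<in> sp E r \<Longrightarrow> cinner p (A x) = cinner p' x"
    and q: "q \<in> K" "q' \<in> sp E s" "\<And>y. y \<in> sp E s \<Longrightarrow> cinner q (V y) = cinner q' y"
    and z: "z \<in> sp E (r @ s)"
  shows "cinner (\<tau> p q) (tensor_op E r s \<tau> A V z) = cinner (ten E r s p' q') z"
proof -
  let ?f = "tensor_op E r s \<tau> A V"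
  note f = tensor_op_isometry[OF src tgt A V]
  have S: "csubspace (sp E (r @ s))"
    using hilbert_tensorD(3)[OF src] by (simp add: hilbert_subspace_def)
  have lin: "clinear_on (sp E (r @ s)) ?f" using f(1) by (simp add: isometry_on_def)
  note Sp = hilbert_tensorD(7)[OF src]
  show ?thesis
    using z[unfolded Sp]
  proof (induction z rule: closure_cspan_induct)
    case (base z)
    then obtain x y where xy: "z = ten E r s x y" "x \<in> sp E r" "y \<in> sp E s" by blast
    moreover have "A x \<in> H" "V y \<in> K" using A V xy by (auto simp: isometry_on_def)
    ultimately show ?case
      using p q by (simp add: f(2) hilbert_tensorD(6)[OF src] hilbert_tensorD(6)[OF tgt])
  next
    case zero
    show ?case using clinear_on_0[OF lin S] by (simp add: cinner.zero_right)
  next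
    case (add y z)
    thus ?case using lin unfolding Sp[symmetric] clinear_on_def by (simp add: cinner_add_right)
  next
    case (scale c y)
    thus ?case using lin unfolding Sp[symmetric] clinear_on_def by (simp add: cinner_scaleC_right)
  next
    case (limit X z)
    have "(\<lambda>n. cinner (\<tau> p q) (?f (X n))) \<longlonglongrightarrow> cinner (\<tau> p q) (?f z)"
      using bounded_clinear_on_tendsto[OF isometry_on_bounded[OF f(1)] S] limit.hyps
      unfolding Sp[symmetric] by (intro cinner.tendsto tendsto_const)
    moreover have "(\<lambda>n. cinner (\<tau> p q) (?f (X n))) \<longlonglongrightarrow> cinner (ten E r s p' q') z"
      unfolding limit.IH[rule_format] by (intro cinner.tendsto tendsto_const limit.hyps(3))
    ultimately show ?case by (rule LIMSEQ_unique)
  qed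
qed

text \<open>Needed because \<open>iter_str E [s, t]\<close> is by definition the structure map
  followed by a tensor product of two identities. The operator is compared with the identity by
  pairing with simple tensors.\<close>

lemma tensor_op_id_id:
  assumes src: "hilbert_tensor (sp E r) (sp E s) (ten E r s) (sp E (r @ s))"
    and z: "z \<in> sp E (r @ s)"
  shows "tensor_op E r s (ten E r s) id id z = z"
proof -
  let ?f = "tensor_op E r s (ten E r s) id id"
  note f = tensor_op_isometry[OF src src isometry_on_id isometry_on_id]
  have S: "csubspace (sp E (r @ s))"
    using hilbert_tensorD(3)[OF src] by (simp add: hilbert_subspace_def)
  have fz: "?f z \<in> sp E (r @ s)" using f(1) z by (auto simp: isometry_on_def)
  show ?thesis
  proof (rule cinner_eqI[OF S fz z])
    fix w assume w: "w \<in> sp E (r @ s)"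
    have "cinner (?f z) w = cinner z w"
      if "w \<in> cspan {ten E r s x y | x y. x \<in> sp E r \<and> y \<in> sp E s}" for w
    proof -
      have "cspan {ten E r s x y | x y. x \<in> sp E r \<and> y \<in> sp E s} \<subseteq> {w. cinner (?f z) w = cinner z w}"
      proof (rule cspan_minimal)
        have "cinner (ten E r s x y) (?f z) = cinner (ten E r s x y) z"
          if "x \<in> sp E r" "y \<in> sp E s" for x y
          by (rule tensor_op_cinner[OF src src isometry_on_id isometry_on_id]) (use that z in auto)
        thus "{ten E r s x y | x y. x \<in> sp E r \<and> y \<in> sp E s} \<subseteq> {w. cinner (?f z) w = cinner z w}"
          by (auto simp: cinner_eq_iff_flip[of "?f z" _ z])
        show "csubspace {w. cinner (?f z) w = cinner z w}"
          by (intro csubspaceI) (auto simp: cinner_add_right cinner_scaleC_right cinner.zero_right)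
      qed
      thus ?thesis using that by blast
    qed
    thus "cinner (?f z) w = cinner z w"
      using w[unfolded hilbert_tensorD(7)[OF src]] by (rule cinner_eq_closure)
  qed
qed


section \<open>Tuples and their refinements\<close>

lemma tuples_iff: "ts \<in> tuples \<longleftrightarrow> ts \<noteq> [] \<and> (\<forall>t\<in>set ts. 0 < t)"
  by (auto simp: tuples_def J_def)

lemma J_iff: "ts \<in> J T \<longleftrightarrow> ts \<in> tuples \<and> sum_list ts = T"
  by (auto simp: tuples_iff J_def)

lemma sum_list_tuples_pos:
  assumes "ts \<in> tuples" shows "0 < sum_list ts"
proof (cases ts)
  case (Cons t ts')
  have "0 \<le> sum_list ts'" using assms Cons by (intro sum_list_nonneg) (auto simp: tuples_iff less_imp_le)
  thus ?thesis using assms Cons by (auto simp: tuples_iff intro: add_pos_nonneg)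
qed (use assms in \<open>simp add: tuples_iff\<close>)

lemma concat_tuples:
  assumes "tss \<noteq> []" "set tss \<subseteq> tuples"
  shows "concat tss \<in> tuples" "map sum_list tss \<in> tuples"
    "sum_list (concat tss) = sum_list (map sum_list tss)"
proof -
  show "concat tss \<in> tuples"
    using assms by (cases tss) (auto simp: tuples_iff subset_iff)
  show "map sum_list tss \<in> tuples"
    using assms sum_list_tuples_pos by (auto simp: tuples_iff[of "map _ _"])
  show "sum_list (concat tss) = sum_list (map sum_list tss)"
    by (induction tss) auto
qed

lemma common_refinement:
  assumes "\<forall>x\<in>set s. 0 < x" "\<forall>x\<in>set t. 0 < x" "sum_list s = sum_list (t :: real list)"
  obtains \<sigma> \<tau> where "set \<sigma> \<subseteq> tuples" "set \<tau> \<subseteq> tuples" "concat \<sigma> = concat \<tau>"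
    "map sum_list \<sigma> = s" "map sum_list \<tau> = t"
proof -
  define R where "R s t \<longleftrightarrow> (\<exists>\<sigma> \<tau>. set \<sigma> \<subseteq> tuples \<and> set \<tau> \<subseteq> tuples \<and> concat \<sigma> = concat \<tau> \<and>
    map sum_list \<sigma> = s \<and> map sum_list \<tau> = t)" for s t
  have sym: "R s t" if "R t s" for s t using that unfolding R_def by metis
  \<comment> \<open>The first block \<open>r\<close> of the second list refines the remainder
    \<open>y - x\<close>; prepending \<open>x\<close> turns it into a block refining
    \<open>y\<close>.\<close>
  have step: "R (x # s) (y # t)" if pos: "0 < x" and R: "R s ((y - x) # t)" for x y s t
  proof -
    obtain \<sigma> \<tau> where st: "set \<sigma> \<subseteq> tuples" "set \<tau> \<subseteq> tuples" "concat \<sigma> = concat \<tau>"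
      "map sum_list \<sigma> = s" "map sum_list \<tau> = (y - x) # t" using R unfolding R_def by (elim exE conjE)
    from st(5) obtain r \<tau>' where "\<tau> = r # \<tau>'" "sum_list r = y - x" "map sum_list \<tau>' = t"
      unfolding map_eq_Cons_conv by (elim exE conjE)
    thus ?thesis
      using st pos unfolding R_def
      by (intro exI[of _ "[x] # \<sigma>"] exI[of _ "(x # r) # \<tau>'"]) (auto simp: tuples_iff)
  qed
  have "R s t"
    using assms
  proof (induction "length s + length t" arbitrary: s t rule: less_induct)
    case less
    have nil: "ts = []" if "\<forall>x\<in>set ts. 0 < x" "sum_list ts = 0" for ts :: "real list"
      using sum_list_tuples_pos[of ts] that by (auto simp: tuples_iff)
    show ?case
    proof (cases "s = [] \<or> t = []")
      case True
      hence "s = [] \<and> t = []" using less.prems nil by auto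
      thus ?thesis by (auto simp: R_def)
    next
      case False
      then obtain x s' y t' where st: "s = x # s'" "t = y # t'" by (metis neq_Nil_conv)
      consider "x = y" | "x < y" | "y < x" by linarith
      thus ?thesis
      proof cases
        case 1
        have "R s' t'" using less.prems st 1 by (intro less.hyps) auto
        then obtain \<sigma> \<tau> where "set \<sigma> \<subseteq> tuples" "set \<tau> \<subseteq> tuples" "concat \<sigma> = concat \<tau>"
          "map sum_list \<sigma> = s'" "map sum_list \<tau> = t'" unfolding R_def by (elim exE conjE)
        thus ?thesis
          using less.prems st 1 unfolding R_def
          by (intro exI[of _ "[x] # \<sigma>"] exI[of _ "[x] # \<tau>"]) (auto simp: tuples_iff)
      next
        case 2
        have "R s' ((y - x) # t')" using less.prems st 2 by (intro less.hyps) auto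
        thus ?thesis using step less.prems st by auto
      next
        case 3
        have "R ((x - y) # s') t'" using less.prems st 3 by (intro less.hyps) auto
        hence "R t s" using step[of y t' x s'] sym less.prems st by auto
        thus ?thesis by (rule sym)
      qed
    qed
  qed
  thus ?thesis using that unfolding R_def by blast
qed


section \<open>Units and addits on tuples\<close>

lemma str_adj_cinner:
  assumes E: "inclusion_system E" and "0 < s" "0 < t" and x: "x \<in> sp E [s + t]"
  shows "cinner (str_adj E s t y) x = cinner y (str E s t x)"
proof -
  have "hilbert_subspace (sp E [s + t])" "isometry_on (sp E [s + t]) (sp E [s, t]) (str E s t)"
    using assms by (auto simp: inclusion_system_def tensor_family_def tuples_iff)
  thus ?thesis using x unfolding str_adj_def by (rule adjoint_on_isometry(2))
qed

lemma str_adj_in: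
  assumes E: "inclusion_system E" and "0 < s" "0 < t"
  shows "str_adj E s t y \<in> sp E [s + t]"
proof -
  have "hilbert_subspace (sp E [s + t])" "isometry_on (sp E [s + t]) (sp E [s, t]) (str E s t)"
    using assms by (auto simp: inclusion_system_def tensor_family_def tuples_iff)
  thus ?thesis unfolding str_adj_def by (rule adjoint_on_isometry(1))
qed

text \<open>The vectors \<open>u\<^bsub>t\<^sub>1\<^esub> \<otimes> \<cdots> \<otimes> u\<^bsub>t\<^sub>n\<^esub>\<close> and \<open>\<Sum>\<^sub>i u\<^bsub>t\<^sub>1\<^esub> \<otimes> \<cdots> \<otimes> a\<^bsub>t\<^sub>i\<^esub> \<otimes> \<cdots> \<otimes> u\<^bsub>t\<^sub>n\<^esub>\<close>.\<close>

fun unit_tensor :: "'a::chilbert_space tensor_system \<Rightarrow> (real \<Rightarrow> 'a) \<Rightarrow> real list \<Rightarrow> 'a" where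
  "unit_tensor E u [] = 0"
| "unit_tensor E u [t] = u t"
| "unit_tensor E u (t # t' # ts) = ten E [t] (t' # ts) (u t) (unit_tensor E u (t' # ts))"

fun addit_tensor ::
    "'a::chilbert_space tensor_system \<Rightarrow> (real \<Rightarrow> 'a) \<Rightarrow> (real \<Rightarrow> 'a) \<Rightarrow> real list \<Rightarrow> 'a" where
  "addit_tensor E u a [] = 0"
| "addit_tensor E u a [t] = a t"
| "addit_tensor E u a (t # t' # ts) =
     ten E [t] (t' # ts) (a t) (unit_tensor E u (t' # ts)) +
     ten E [t] (t' # ts) (u t) (addit_tensor E u a (t' # ts))"

lemma unit_tensor_Cons:
  "ts \<noteq> [] \<Longrightarrow> unit_tensor E u (t # ts) = ten E [t] ts (u t) (unit_tensor E u ts)"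
  by (cases ts) auto

lemma addit_tensor_Cons:
  "ts \<noteq> [] \<Longrightarrow> addit_tensor E u a (t # ts) =
     ten E [t] ts (a t) (unit_tensor E u ts) + ten E [t] ts (u t) (addit_tensor E u a ts)"
  by (cases ts) auto

lemma iter_str_Cons:
  "ts \<noteq> [] \<Longrightarrow> iter_str E (t # ts) =
     tensor_op E [t] [sum_list ts] (ten E [t] ts) id (iter_str E ts) \<circ> str E t (sum_list ts)"
  by (cases ts) auto

lemma refine_str_Cons:
  "tss \<noteq> [] \<Longrightarrow> refine_str E (ts # tss) =
     tensor_op E [sum_list ts] (map sum_list tss) (ten E ts (concat tss)) (iter_str E ts) (refine_str E tss)"
  by (cases tss) auto

lemma tuples_induct [consumes 1, case_names single Cons]:
  assumes "ts \<in> tuples"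
    and "\<And>t. 0 < t \<Longrightarrow> P [t]"
    and "\<And>t ts. \<lbrakk>0 < t; ts \<in> tuples; P ts\<rbrakk> \<Longrightarrow> P (t # ts)"
  shows "P ts"
  using assms(1)
proof (induction ts)
  case (Cons t ts)
  show ?case
    using Cons assms(2,3) by (cases "ts = []") (auto simp: tuples_iff)
qed (simp add: tuples_iff)

section \<open>Tensors of the unit and their behaviour under refinement\<close>

locale pointed =
  fixes E :: "'a::chilbert_space tensor_system" and u :: "real \<Rightarrow> 'a"
  assumes pointed: "pointed_inclusion_system E u"
begin

lemma incl: "inclusion_system E" and unit: "u \<in> units E" and norm_unit: "0 < t \<Longrightarrow> norm (u t) = 1"
  using pointed by (auto simp: pointed_inclusion_system_def)

lemma hilbert_sp: "r \<in> tuples \<Longrightarrow> hilbert_subspace (sp E r)"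
  using incl by (auto simp: inclusion_system_def tensor_family_def)

lemma csubspace_sp: "r \<in> tuples \<Longrightarrow> csubspace (sp E r)"
  using hilbert_sp by (auto simp: hilbert_subspace_def)

lemma tensor_sp:
  "r \<in> tuples \<Longrightarrow> s \<in> tuples \<Longrightarrow> hilbert_tensor (sp E r) (sp E s) (ten E r s) (sp E (r @ s))"
  using incl by (auto simp: inclusion_system_def tensor_family_def)

lemma tensor_sp_Cons:
  "0 < t \<Longrightarrow> ts \<in> tuples \<Longrightarrow> hilbert_tensor (sp E [t]) (sp E ts) (ten E [t] ts) (sp E (t # ts))"
  using tensor_sp[of "[t]" ts] by (simp add: tuples_iff)

lemma tensor_sp_pair:
  "0 < s \<Longrightarrow> 0 < t \<Longrightarrow> hilbert_tensor (sp E [s]) (sp E [t]) (ten E [s] [t]) (sp E [s, t])"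
  using tensor_sp_Cons[of s "[t]"] by (simp add: tuples_iff)

lemma ten_assoc:
  "\<lbrakk>r \<in> tuples; s \<in> tuples; t \<in> tuples; x \<in> sp E r; y \<in> sp E s; z \<in> sp E t\<rbrakk> \<Longrightarrow>
    ten E (r @ s) t (ten E r s x y) z = ten E r (s @ t) x (ten E s t y z)"
  using incl by (auto simp: inclusion_system_def tensor_family_def)

lemma str_isometry: "0 < s \<Longrightarrow> 0 < t \<Longrightarrow> isometry_on (sp E [s + t]) (sp E [s, t]) (str E s t)"
  using incl by (auto simp: inclusion_system_def)

lemma section_in: "a \<in> sections E \<Longrightarrow> 0 < t \<Longrightarrow> a t \<in> sp E [t]"
  by (auto simp: sections_def)

lemma unit_in: "0 < t \<Longrightarrow> u t \<in> sp E [t]"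
  using unit section_in by (auto simp: units_def)

lemma unit_add: "0 < s \<Longrightarrow> 0 < t \<Longrightarrow> u (s + t) = str_adj E s t (ten E [s] [t] (u s) (u t))"
  using unit by (auto simp: units_def)

lemma unit_tensor_in: "ts \<in> tuples \<Longrightarrow> unit_tensor E u ts \<in> sp E ts"
proof (induction ts rule: tuples_induct)
  case (Cons t ts)
  thus ?case
    using hilbert_tensor_in[OF tensor_sp_Cons unit_in] by (simp add: unit_tensor_Cons tuples_iff)
qed (simp add: unit_in)

lemma addit_tensor_in:
  assumes "a \<in> sections E" "ts \<in> tuples"
  shows "addit_tensor E u a ts \<in> sp E ts"
  using assms(2)
proof (induction ts rule: tuples_induct)
  case (Cons t ts)
  hence "ts \<noteq> []" "t # ts \<in> tuples" by (auto simp: tuples_iff)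
  moreover note hilbert_tensor_in[OF tensor_sp_Cons[OF Cons.hyps]]
  ultimately show ?case
    unfolding addit_tensor_Cons[OF \<open>ts \<noteq> []\<close>]
    using Cons section_in[OF assms(1)] unit_in unit_tensor_in csubspace_sp by (intro csubspace_add) auto
qed (simp add: section_in[OF assms(1)])

lemma norm_unit_tensor: "ts \<in> tuples \<Longrightarrow> norm (unit_tensor E u ts) = 1"
proof (induction ts rule: tuples_induct)
  case (Cons t ts)
  thus ?case
    using norm_hilbert_tensor[OF tensor_sp_Cons unit_in unit_tensor_in, of t ts] norm_unit
    by (simp add: unit_tensor_Cons tuples_iff)
qed (simp add: norm_unit)

text \<open>The recursion brackets to the right; strict associativity permits a cut at any
  place.\<close>

lemma unit_tensor_append:
  assumes "r \<in> tuples" "s \<in> tuples"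
  shows "unit_tensor E u (r @ s) = ten E r s (unit_tensor E u r) (unit_tensor E u s)"
  using assms(1)
proof (induction r rule: tuples_induct)
  case (single t)
  show ?case using assms(2) by (simp add: unit_tensor_Cons tuples_iff)
next
  case (Cons t ts)
  have "[t] \<in> tuples" "ts \<noteq> []" using Cons.hyps by (auto simp: tuples_iff)
  thus ?case
    using Cons ten_assoc[of "[t]" ts s "u t" "unit_tensor E u ts" "unit_tensor E u s"] assms(2)
      unit_tensor_in unit_in
    by (simp add: unit_tensor_Cons)
qed

text \<open>Leibniz rule for a cut at any place, whereas the recursion cuts off only the first
  entry. Bilinearity expands the terms and associativity moves the brackets.\<close>

lemma addit_tensor_append:
  assumes a: "a \<in> sections E" and "r \<in> tuples" "s \<in> tuples"
  shows "addit_tensor E u a (r @ s) =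
    ten E r s (addit_tensor E u a r) (unit_tensor E u s) + ten E r s (unit_tensor E u r) (addit_tensor E u a s)"
  using assms(2)
proof (induction r rule: tuples_induct)
  case (single t)
  show ?case using assms(3) by (simp add: addit_tensor_Cons tuples_iff)
next
  case (Cons t ts)
  have t: "[t] \<in> tuples" "ts \<noteq> []" "t # ts \<in> tuples" using Cons.hyps by (auto simp: tuples_iff)
  have ts_s: "ts @ s \<in> tuples" using Cons.hyps assms(3) by (auto simp: tuples_iff)
  let ?U = "unit_tensor E u" and ?A = "addit_tensor E u a"
  note mem = section_in[OF a \<open>0 < t\<close>] unit_in[OF \<open>0 < t\<close>] unit_tensor_in addit_tensor_in[OF a]
    hilbert_tensor_in[OF tensor_sp] hilbert_tensor_in[OF tensor_sp_Cons]
  \<comment> \<open>In the three terms \<open>a\<close> occupies the first entry, a place in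
    \<open>ts\<close>, and a place in \<open>s\<close>.\<close>
  have "?A (t # ts @ s) = ten E [t] (ts @ s) (a t) (ten E ts s (?U ts) (?U s)) +
      (ten E [t] (ts @ s) (u t) (ten E ts s (?A ts) (?U s)) +
       ten E [t] (ts @ s) (u t) (ten E ts s (?U ts) (?A s)))"
    using Cons t ts_s assms(3) mem hilbert_tensorD(4)[OF tensor_sp_Cons[OF \<open>0 < t\<close> ts_s]]
    by (simp add: addit_tensor_Cons unit_tensor_append)
  also have "\<dots> = ten E (t # ts) s (ten E [t] ts (a t) (?U ts)) (?U s) +
      (ten E (t # ts) s (ten E [t] ts (u t) (?A ts)) (?U s) +
       ten E (t # ts) s (ten E [t] ts (u t) (?U ts)) (?A s))"
    using ten_assoc[OF t(1) Cons.hyps(2) assms(3)] Cons.hyps assms(3) mem by simp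
  also have "\<dots> = ten E (t # ts) s (?A (t # ts)) (?U s) + ten E (t # ts) s (?U (t # ts)) (?A s)"
    using hilbert_tensorD(5)[OF tensor_sp[OF t(3) assms(3)]] Cons.hyps assms(3) mem t(2)
    by (simp add: addit_tensor_Cons unit_tensor_Cons)
  finally show ?case by simp
qed

lemma iter_str_isometry:
  "ts \<in> tuples \<Longrightarrow> isometry_on (sp E [sum_list ts]) (sp E ts) (iter_str E ts)"
proof (induction ts rule: tuples_induct)
  case (single t)
  show ?case by (simp add: isometry_on_def clinear_on_def)
next
  case (Cons t ts)
  have pos: "0 < sum_list ts" and ne: "ts \<noteq> []"
    using Cons.hyps sum_list_tuples_pos by (auto simp: tuples_iff)
  have "isometry_on (sp E ([t] @ [sum_list ts])) (sp E (t # ts))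
      (tensor_op E [t] [sum_list ts] (ten E [t] ts) id (iter_str E ts))"
    using tensor_sp_pair[OF Cons.hyps(1) pos] tensor_sp_Cons[OF Cons.hyps(1,2)]
    by (intro tensor_op_isometry(1)[OF _ _ isometry_on_id Cons.IH]) simp_all
  thus ?case
    unfolding iter_str_Cons[OF ne] append_Cons append_Nil sum_list.Cons
    by (rule isometry_on_comp[OF str_isometry[OF Cons.hyps(1) pos]])
qed

lemma iter_str_pair:
  assumes "0 < s" "0 < t" "x \<in> sp E [s + t]"
  shows "iter_str E [s, t] x = str E s t x"
proof -
  have "str E s t x \<in> sp E ([s] @ [t])"
    using str_isometry[OF assms(1,2)] assms(3) by (auto simp: isometry_on_def)
  thus ?thesis
    using tensor_op_id_id[of E "[s]" "[t]"] tensor_sp_pair[OF assms(1,2)] by simp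
qed

lemma refine_str_isometry:
  assumes "tss \<noteq> []" "set tss \<subseteq> tuples"
  shows "isometry_on (sp E (map sum_list tss)) (sp E (concat tss)) (refine_str E tss)"
  using assms
proof (induction tss)
  case (Cons ts tss)
  show ?case
  proof (cases "tss = []")
    case True
    thus ?thesis using iter_str_isometry Cons.prems by simp
  next
    case False
    hence tss: "concat tss \<in> tuples" "map sum_list tss \<in> tuples"
      using concat_tuples Cons.prems by auto
    have ts: "ts \<in> tuples" "0 < sum_list ts" using Cons.prems sum_list_tuples_pos by auto
    show ?thesis
      unfolding refine_str_Cons[OF False]
      using tensor_op_isometry(1)[OF tensor_sp tensor_sp[OF ts(1) tss(1)] iter_str_isometry[OF ts(1)],
          of "map sum_list tss" "refine_str E tss"] Cons False tss ts
      by (simp add: tuples_iff[of "[_]"])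
  qed
qed simp

text \<open>\<open>tensor_op_cinner\<close> removes the operator on the tail and the unit equation
  removes the structure map. Adjoints of iterated maps are expressed by such pairings throughout;
  here the adjoint sends the unit tensor back to the unit.\<close>

lemma cinner_unit_iter_str:
  "ts \<in> tuples \<Longrightarrow> x \<in> sp E [sum_list ts] \<Longrightarrow>
    cinner (unit_tensor E u ts) (iter_str E ts x) = cinner (u (sum_list ts)) x"
proof (induction ts arbitrary: x rule: tuples_induct)
  case (Cons t ts)
  have pos: "0 < sum_list ts" and ne: "ts \<noteq> []"
    using Cons.hyps sum_list_tuples_pos by (auto simp: tuples_iff)
  have "str E t (sum_list ts) x \<in> sp E ([t] @ [sum_list ts])"
    using str_isometry[OF Cons.hyps(1) pos] Cons.prems by (auto simp: isometry_on_def)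
  hence "cinner (unit_tensor E u (t # ts)) (iter_str E (t # ts) x) =
      cinner (ten E [t] [sum_list ts] (u t) (u (sum_list ts))) (str E t (sum_list ts) x)"
    unfolding iter_str_Cons[OF ne] unit_tensor_Cons[OF ne] comp_apply
    using Cons pos unit_in unit_tensor_in tensor_sp_pair
    by (intro tensor_op_cinner[OF _ tensor_sp_Cons[OF Cons.hyps(1,2)] isometry_on_id
        iter_str_isometry[OF Cons.hyps(2)]]) simp_all
  thus ?case
    using str_adj_cinner[OF incl Cons.hyps(1) pos] Cons.prems unit_add[OF Cons.hyps(1) pos] by simp
qed simp

text \<open>Normalisation enters here: both vectors have norm one and, by
  \<open>cinner_unit_iter_str\<close>, inner product one. So the isometry itself, and not only its
  adjoint, respects the unit.\<close>

lemma iter_str_unit: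
  assumes "ts \<in> tuples"
  shows "iter_str E ts (u (sum_list ts)) = unit_tensor E u ts"
proof (rule sym, rule eq_of_cinner_eq_1)
  have pos: "0 < sum_list ts" using assms by (rule sum_list_tuples_pos)
  show "norm (unit_tensor E u ts) = 1" using assms by (rule norm_unit_tensor)
  show "norm (iter_str E ts (u (sum_list ts))) = 1"
    using iter_str_isometry[OF assms] unit_in[OF pos] norm_unit[OF pos] by (simp add: isometry_on_def)
  show "cinner (unit_tensor E u ts) (iter_str E ts (u (sum_list ts))) = 1"
    using cinner_unit_iter_str[OF assms unit_in[OF pos]] norm_unit[OF pos] by (simp add: cinner_self)
qed

text \<open>The first block is covered by \<open>cinner_unit_iter_str\<close>, the others by
  induction, and \<open>tensor_op_cinner\<close> joins them.\<close>

lemma cinner_unit_refine_str: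
  assumes "tss \<noteq> []" "set tss \<subseteq> tuples" "x \<in> sp E (map sum_list tss)"
  shows "cinner (unit_tensor E u (concat tss)) (refine_str E tss x) =
    cinner (unit_tensor E u (map sum_list tss)) x"
  using assms
proof (induction tss arbitrary: x)
  case (Cons ts tss)
  show ?case
  proof (cases "tss = []")
    case True
    thus ?thesis using cinner_unit_iter_str Cons.prems by simp
  next
    case False
    hence tss: "concat tss \<in> tuples" "map sum_list tss \<in> tuples" "set tss \<subseteq> tuples"
      using concat_tuples Cons.prems by auto
    have ts: "ts \<in> tuples" "0 < sum_list ts" using Cons.prems sum_list_tuples_pos by auto
    have sgl: "[sum_list ts] \<in> tuples" using ts by (simp add: tuples_iff)
    have ne: "map sum_list tss \<noteq> []" using False by simp
    show ?thesis
      unfolding refine_str_Cons[OF False] concat.simps list.map unit_tensor_append[OF ts(1) tss(1)]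
        unit_tensor_Cons[OF ne]
      using Cons.prems Cons.IH[OF False tss(3)] tss ts unit_in unit_tensor_in cinner_unit_iter_str
      by (intro tensor_op_cinner[OF tensor_sp[OF sgl tss(2)] tensor_sp[OF ts(1) tss(1)]
          iter_str_isometry[OF ts(1)] refine_str_isometry[OF False tss(3)]]) simp_all
  qed
qed simp

end

section \<open>Tensors of an addit: compatibility under refinement and a uniform norm bound\<close>

locale pointed_addit = pointed E u for E :: "'a::chilbert_space tensor_system" and u +
  fixes a :: "real \<Rightarrow> 'a"
  assumes addit: "a \<in> addits E u"
begin

lemma addit_section: "a \<in> sections E"
  using addit by (simp add: addits_def)

lemmas addit_in = section_in[OF addit_section]

lemma addit_add:
  "0 < s \<Longrightarrow> 0 < t \<Longrightarrow>
    a (s + t) = str_adj E s t (ten E [s] [t] (a s) (u t) + ten E [s] [t] (u s) (a t))"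
  using addit by (simp add: addits_def)

text \<open>The two summands are simple tensors and are dualised separately: the tail is a unit
  tensor in one, covered by \<open>cinner_unit_iter_str\<close>, and an addit tensor in the other,
  covered by induction. The addit equation reassembles them.\<close>

lemma cinner_addit_iter_str:
  "ts \<in> tuples \<Longrightarrow> x \<in> sp E [sum_list ts] \<Longrightarrow>
    cinner (addit_tensor E u a ts) (iter_str E ts x) = cinner (a (sum_list ts)) x"
proof (induction ts arbitrary: x rule: tuples_induct)
  case (Cons t ts)
  let ?T = "sum_list ts" and ?f = "tensor_op E [t] [sum_list ts] (ten E [t] ts) id (iter_str E ts)"
  have pos: "0 < ?T" and ne: "ts \<noteq> []"
    using Cons.hyps sum_list_tuples_pos by (auto simp: tuples_iff)
  have strx: "str E t ?T x \<in> sp E ([t] @ [?T])"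
    using str_isometry[OF Cons.hyps(1) pos] Cons.prems by (auto simp: isometry_on_def)
  have src: "hilbert_tensor (sp E [t]) (sp E [?T]) (ten E [t] [?T]) (sp E ([t] @ [?T]))"
    using tensor_sp_pair[OF Cons.hyps(1) pos] by simp
  note dual = tensor_op_cinner[OF src tensor_sp_Cons[OF Cons.hyps(1,2)] isometry_on_id
      iter_str_isometry[OF Cons.hyps(2)] _ _ _ _ _ _ strx]
  have "cinner (ten E [t] ts (a t) (unit_tensor E u ts)) (?f (str E t ?T x)) =
      cinner (ten E [t] [?T] (a t) (u ?T)) (str E t ?T x)"
    using Cons pos unit_in unit_tensor_in addit_in cinner_unit_iter_str by (intro dual) simp_all
  moreover have "cinner (ten E [t] ts (u t) (addit_tensor E u a ts)) (?f (str E t ?T x)) =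
      cinner (ten E [t] [?T] (u t) (a ?T)) (str E t ?T x)"
    using Cons pos unit_in addit_in addit_tensor_in[OF addit_section] by (intro dual) simp_all
  ultimately show ?case
    using str_adj_cinner[OF incl Cons.hyps(1) pos] Cons.prems addit_add[OF Cons.hyps(1) pos]
    by (simp add: iter_str_Cons[OF ne] addit_tensor_Cons[OF ne] cinner_add_left)
qed simp

text \<open>This compatibility will make the pairing with addit tensors independent of the tuple
  over which a vector is represented. The Leibniz rule splits off the first block, and the two terms
  are dualised separately.\<close>

lemma cinner_addit_refine_str:
  assumes "tss \<noteq> []" "set tss \<subseteq> tuples" "x \<in> sp E (map sum_list tss)"
  shows "cinner (addit_tensor E u a (concat tss)) (refine_str E tss x) =
    cinner (addit_tensor E u a (map sum_list tss)) x"
  using assms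
proof (induction tss arbitrary: x)
  case (Cons ts tss)
  show ?case
  proof (cases "tss = []")
    case True
    thus ?thesis using cinner_addit_iter_str Cons.prems by simp
  next
    case False
    hence tss: "concat tss \<in> tuples" "map sum_list tss \<in> tuples" "set tss \<subseteq> tuples"
      using concat_tuples Cons.prems by auto
    have ts: "ts \<in> tuples" "0 < sum_list ts" using Cons.prems sum_list_tuples_pos by auto
    have sgl: "[sum_list ts] \<in> tuples" using ts by (simp add: tuples_iff)
    have ne: "map sum_list tss \<noteq> []" using False by simp
    have x: "x \<in> sp E ([sum_list ts] @ map sum_list tss)" using Cons.prems by simp
    note dual = tensor_op_cinner[OF tensor_sp[OF sgl tss(2)] tensor_sp[OF ts(1) tss(1)]
        iter_str_isometry[OF ts(1)] refine_str_isometry[OF False tss(3)] _ _ _ _ _ _ x]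
    note mem = tss ts unit_in unit_tensor_in addit_in addit_tensor_in[OF addit_section]
    have "cinner (ten E ts (concat tss) (addit_tensor E u a ts) (unit_tensor E u (concat tss)))
        (refine_str E (ts # tss) x) =
        cinner (ten E [sum_list ts] (map sum_list tss) (a (sum_list ts))
          (unit_tensor E u (map sum_list tss))) x"
      unfolding refine_str_Cons[OF False]
      using mem cinner_addit_iter_str cinner_unit_refine_str[OF False tss(3)] by (intro dual) simp_all
    moreover have "cinner (ten E ts (concat tss) (unit_tensor E u ts) (addit_tensor E u a (concat tss)))
        (refine_str E (ts # tss) x) =
        cinner (ten E [sum_list ts] (map sum_list tss) (u (sum_list ts))
          (addit_tensor E u a (map sum_list tss))) x"
      unfolding refine_str_Cons[OF False]
      using mem cinner_unit_iter_str Cons.IH[OF False tss(3)] by (intro dual) simp_all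
    ultimately show ?thesis
      unfolding concat.simps list.map addit_tensor_append[OF addit_section ts(1) tss(1)]
        addit_tensor_Cons[OF ne] cinner_add_left by simp
  qed
qed simp

text \<open>By \<open>iter_str_unit\<close> the unit tensor is the image of the unit under
  \<open>iter_str E ts\<close>, so the pairing descends to the undivided interval.\<close>

lemma cinner_addit_tensor_unit_tensor:
  assumes "ts \<in> tuples"
  shows "cinner (addit_tensor E u a ts) (unit_tensor E u ts) = cinner (a (sum_list ts)) (u (sum_list ts))"
  using cinner_addit_iter_str[OF assms unit_in] sum_list_tuples_pos[OF assms] iter_str_unit[OF assms]
  by simp

text \<open>The previous lemma over \<open>[s, t]\<close>: each summand splits off a factor
  \<open>cinner (u r) (u r) = 1\<close>.\<close>

lemma cinner_addit_unit_add:
  assumes "0 < s" "0 < t"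
  shows "cinner (a (s + t)) (u (s + t)) = cinner (a s) (u s) + cinner (a t) (u t)"
proof -
  note ten = hilbert_tensorD(6)[OF tensor_sp_pair[OF assms]]
  have "cinner (u t) (u t) = 1" "cinner (u s) (u s) = 1"
    using assms norm_unit by (simp_all add: cinner_self)
  moreover have "[s, t] \<in> tuples" using assms by (simp add: tuples_iff)
  ultimately show ?thesis
    using cinner_addit_tensor_unit_tensor[of "[s, t]"] assms unit_in addit_in
    by (simp add: cinner_add_left ten)
qed

text \<open>The differences \<open>\<parallel>a\<^sub>t\<parallel>\<^sup>2 - \<bar>\<langle>a\<^sub>t, u\<^sub>t\<rangle>\<bar>\<^sup>2\<close> add up along a tuple.\<close>

lemma norm_addit_tensor_le_aux:
  assumes k: "0 \<le> k" "\<And>t. 0 < t \<Longrightarrow> (norm (a t))\<^sup>2 \<le> k * (t + t\<^sup>2)" and "ts \<in> tuples"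
  shows "(norm (addit_tensor E u a ts))\<^sup>2 \<le>
    (cmod (cinner (a (sum_list ts)) (u (sum_list ts))))\<^sup>2 + k * (sum_list ts + (sum_list ts)\<^sup>2)"
  using assms(3)
proof (induction ts rule: tuples_induct)
  case (single t)
  thus ?case using k(2)[of t] by (simp add: add_increasing)
next
  case (Cons t ts)
  define T where "T = sum_list ts"
  define c where "c = cinner (a t) (u t)"
  define d where "d = cinner (a T) (u T)"
  have T: "0 < T" and ne: "ts \<noteq> []"
    using Cons.hyps sum_list_tuples_pos by (auto simp: tuples_iff T_def)
  note mem = Cons.hyps unit_in unit_tensor_in addit_in addit_tensor_in[OF addit_section]
  note tensor = tensor_sp_Cons[OF Cons.hyps(1,2)]
  \<comment> \<open>This supplies the second factor of the cross term, which becomes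
    \<open>c * cnj d\<close>.\<close>
  have "cinner (unit_tensor E u ts) (addit_tensor E u a ts) = cnj d"
    using cinner_addit_tensor_unit_tensor[OF Cons.hyps(2)]
    by (subst cinner_commute) (simp add: d_def T_def)
  hence "(norm (addit_tensor E u a (t # ts)))\<^sup>2 =
      (norm (a t))\<^sup>2 + (norm (addit_tensor E u a ts))\<^sup>2 + 2 * Re (c * cnj d)"
    using mem norm_unit norm_unit_tensor
    by (simp add: addit_tensor_Cons[OF ne] norm_add_square norm_hilbert_tensor[OF tensor]
        hilbert_tensorD(6)[OF tensor] c_def)
  also have "\<dots> \<le> k * (t + t\<^sup>2) + ((cmod d)\<^sup>2 + k * (T + T\<^sup>2)) + 2 * Re (c * cnj d)"
    using k(2)[OF Cons.hyps(1)] Cons.IH by (simp add: T_def d_def)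
  \<comment> \<open>A nonnegative \<open>(cmod c)\<^sup>2\<close> is added so that the cross term
    completes the square of \<open>c + d\<close>.\<close>
  also have "\<dots> \<le> (cmod c)\<^sup>2 + (cmod d)\<^sup>2 + 2 * Re (c * cnj d) + k * (t + t\<^sup>2 + T + T\<^sup>2)"
    by (simp add: algebra_simps)
  also have "(cmod c)\<^sup>2 + (cmod d)\<^sup>2 + 2 * Re (c * cnj d) = (cmod (c + d))\<^sup>2"
    unfolding cmod_power2 by (simp add: power2_eq_square algebra_simps)
  also have "k * (t + t\<^sup>2 + T + T\<^sup>2) \<le> k * (t + T + (t + T)\<^sup>2)"
    using k(1) T Cons.hyps(1) by (intro mult_left_mono) (auto simp: power2_sum)
  also have "c + d = cinner (a (t + T)) (u (t + T))"
    using cinner_addit_unit_add[OF Cons.hyps(1) T] by (simp add: c_def d_def)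
  finally show ?case by (simp add: T_def)
qed

text \<open>Cauchy-Schwarz at the total length bounds the remaining \<open>cmod\<close> term by a
  second copy of the growth bound. The estimate depends on the tuple only through its sum.\<close>

lemma norm_addit_tensor_le:
  assumes k: "0 \<le> k" "\<And>t. 0 < t \<Longrightarrow> (norm (a t))\<^sup>2 \<le> k * (t + t\<^sup>2)" and "ts \<in> tuples"
  shows "(norm (addit_tensor E u a ts))\<^sup>2 \<le> 2 * k * (sum_list ts + (sum_list ts)\<^sup>2)"
proof -
  let ?T = "sum_list ts"
  have "cmod (cinner (a ?T) (u ?T)) \<le> norm (a ?T)"
    using cauchy_schwarz[of "a ?T" "u ?T"] norm_unit sum_list_tuples_pos[OF assms(3)] by simp
  hence "(cmod (cinner (a ?T) (u ?T)))\<^sup>2 \<le> k * (?T + ?T\<^sup>2)"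
    using power_mono[of _ "norm (a ?T)" 2] k(2)[OF sum_list_tuples_pos[OF assms(3)]]
    by (meson norm_ge_zero order_trans)
  moreover have "2 * k * (?T + ?T\<^sup>2) = k * (?T + ?T\<^sup>2) + k * (?T + ?T\<^sup>2)" by simp
  ultimately show ?thesis using norm_addit_tensor_le_aux[OF assms] by linarith
qed

end

section \<open>The generated product system\<close>

locale generated = pointed E u for E :: "'a::chilbert_space tensor_system" and u +
  fixes F :: "'b::chilbert_space tensor_system" and \<iota> :: "real list \<Rightarrow> 'a \<Rightarrow> 'b"
    and u_hat :: "real \<Rightarrow> 'b"
  assumes generated: "generated_product_system E F \<iota>"
    and lift: "is_lift E F \<iota> u u_hat"
begin

lemma incl_F: "inclusion_system F"
  using generated by (simp add: generated_product_system_def product_system_def)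

lemma tensor_family_F: "tensor_family F"
  using incl_F unfolding inclusion_system_def by (elim conjE)

lemma hilbert_F: "0 < T \<Longrightarrow> hilbert_subspace (sp F [T])"
  using tensor_family_F by (simp add: tensor_family_def tuples_iff)

lemma csubspace_F: "0 < T \<Longrightarrow> csubspace (sp F [T])"
  using hilbert_F by (simp add: hilbert_subspace_def)

lemma tensor_F:
  assumes "0 < S" "0 < T"
  shows "hilbert_tensor (sp F [S]) (sp F [T]) (ten F [S] [T]) (sp F [S, T])"
proof -
  have "\<forall>r\<in>tuples. \<forall>s\<in>tuples. hilbert_tensor (sp F r) (sp F s) (ten F r s) (sp F (r @ s))"
    using tensor_family_F unfolding tensor_family_def by (elim conjE)
  from this[rule_format, of "[S]" "[T]"] show ?thesis using assms by (simp add: tuples_iff)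
qed

lemma inductive_limit:
  assumes "0 < T"
  shows "\<forall>t\<in>J T. isometry_on (sp E t) (sp F [T]) (\<iota> t)"
    and "\<forall>tss. tss \<noteq> [] \<and> set tss \<subseteq> tuples \<and> concat tss \<in> J T \<longrightarrow>
        (\<forall>x\<in>sp E (map sum_list tss). \<iota> (concat tss) (refine_str E tss x) = \<iota> (map sum_list tss) x)"
    and "sp F [T] = closure (\<Union>t\<in>J T. \<iota> t ` sp E t)"
proof -
  have "inductive_limit E (sp F [T]) \<iota> T"
    using generated assms by (simp add: generated_product_system_def)
  note lim = this[unfolded inductive_limit_def]
  show "\<forall>t\<in>J T. isometry_on (sp E t) (sp F [T]) (\<iota> t)"
    and "\<forall>tss. tss \<noteq> [] \<and> set tss \<subseteq> tuples \<and> concat tss \<in> J T \<longrightarrow>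
        (\<forall>x\<in>sp E (map sum_list tss). \<iota> (concat tss) (refine_str E tss x) = \<iota> (map sum_list tss) x)"
    and "sp F [T] = closure (\<Union>t\<in>J T. \<iota> t ` sp E t)"
    using lim by - (elim conjE, assumption)+
qed

lemma iota_isometry: "ts \<in> tuples \<Longrightarrow> isometry_on (sp E ts) (sp F [sum_list ts]) (\<iota> ts)"
  using inductive_limit(1)[OF sum_list_tuples_pos] by (simp add: J_iff)

lemma iota_in: "ts \<in> tuples \<Longrightarrow> x \<in> sp E ts \<Longrightarrow> \<iota> ts x \<in> sp F [sum_list ts]"
  using iota_isometry by (auto simp: isometry_on_def)

lemma iota_refine:
  assumes "tss \<noteq> []" "set tss \<subseteq> tuples" "x \<in> sp E (map sum_list tss)"
  shows "\<iota> (concat tss) (refine_str E tss x) = \<iota> (map sum_list tss) x"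
proof -
  have "concat tss \<in> tuples" using concat_tuples assms by blast
  thus ?thesis
    using inductive_limit(2)[OF sum_list_tuples_pos, of "concat tss"] assms by (simp add: J_iff)
qed

lemma str_iota:
  assumes "s \<in> tuples" "t \<in> tuples" "x \<in> sp E (s @ t)"
  shows "str F (sum_list s) (sum_list t) (\<iota> (s @ t) x) =
    tensor_op E s t (ten F [sum_list s] [sum_list t]) (\<iota> s) (\<iota> t) x"
proof -
  have "s \<in> J (sum_list s)" "t \<in> J (sum_list t)" using assms by (simp_all add: J_iff)
  thus ?thesis
    using generated assms sum_list_tuples_pos by (simp add: generated_product_system_def)
qed

text \<open>The structure map of \<open>F\<close> after \<open>\<iota> (s @ t)\<close> is the tensor
  product of \<open>\<iota> s\<close> and \<open>\<iota> t\<close>, so its adjoint acts factorwise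
  on simple tensors.\<close>

lemma cinner_tensor_iota:
  assumes st: "s \<in> tuples" "t \<in> tuples"
    and p: "p \<in> sp F [sum_list s]" "p' \<in> sp E s" "\<And>x. x \<in> sp E s \<Longrightarrow> cinner p (\<iota> s x) = cinner p' x"
    and q: "q \<in> sp F [sum_list t]" "q' \<in> sp E t" "\<And>x. x \<in> sp E t \<Longrightarrow> cinner q (\<iota> t x) = cinner q' x"
    and x: "x \<in> sp E (s @ t)"
  shows "cinner (ten F [sum_list s] [sum_list t] p q) (str F (sum_list s) (sum_list t) (\<iota> (s @ t) x)) =
    cinner (ten E s t p' q') x"
  unfolding str_iota[OF st x]
  by (rule tensor_op_cinner[OF tensor_sp[OF st] tensor_F iota_isometry iota_isometry])
     (use st p q x in \<open>simp_all add: sum_list_tuples_pos\<close>)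

section \<open>The algebraic inductive limit, a dense subspace of each fibre\<close>

definition finite_part :: "real \<Rightarrow> 'b set" where
  "finite_part T = (\<Union>t\<in>J T. \<iota> t ` sp E t)"

lemma closure_finite_part: "0 < T \<Longrightarrow> closure (finite_part T) = sp F [T]"
  using inductive_limit(3) by (simp add: finite_part_def)

lemma common_tuple:
  assumes "s \<in> J T" "t \<in> J T"
  obtains \<sigma> \<tau> where "set \<sigma> \<subseteq> tuples" "set \<tau> \<subseteq> tuples" "concat \<sigma> = concat \<tau>"
    "map sum_list \<sigma> = s" "map sum_list \<tau> = t" "\<sigma> \<noteq> []" "\<tau> \<noteq> []" "concat \<tau> \<in> J T"
proof -
  have st: "\<forall>x\<in>set s. 0 < x" "\<forall>x\<in>set t. 0 < x" "sum_list s = sum_list t" "s \<noteq> []" "t \<noteq> []"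
    "sum_list t = T"
    using assms by (auto simp: J_def)
  obtain \<sigma> \<tau> where r: "set \<sigma> \<subseteq> tuples" "set \<tau> \<subseteq> tuples" "concat \<sigma> = concat \<tau>"
    "map sum_list \<sigma> = s" "map sum_list \<tau> = t"
    by (rule common_refinement[OF st(1-3)])
  hence ne: "\<sigma> \<noteq> []" "\<tau> \<noteq> []" using st by auto
  have "concat \<tau> \<in> J T" using concat_tuples[OF ne(2) r(2)] r(5) st(6) by (simp add: J_iff)
  thus ?thesis using that r ne by blast
qed

lemma refine_str_in:
  "tss \<noteq> [] \<Longrightarrow> set tss \<subseteq> tuples \<Longrightarrow> x \<in> sp E (map sum_list tss) \<Longrightarrow> refine_str E tss x \<in> sp E (concat tss)"
  using refine_str_isometry by (auto simp: isometry_on_def)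

lemma tuple_of_J: "s \<in> J T \<Longrightarrow> s \<in> tuples"
  by (simp add: J_iff)

text \<open>A common refinement of the two tuples carries both vectors, by compatibility of the maps
  \<open>\<iota>\<close>. Linear operations can then be performed inside a single space
  \<open>sp E r\<close>.\<close>

lemma finite_part_pair:
  assumes "y \<in> finite_part T" "z \<in> finite_part T"
  obtains r x w where "r \<in> J T" "x \<in> sp E r" "w \<in> sp E r" "y = \<iota> r x" "z = \<iota> r w"
proof -
  obtain s t x w where s: "s \<in> J T" "x \<in> sp E s" "y = \<iota> s x" and t: "t \<in> J T" "w \<in> sp E t" "z = \<iota> t w"
    using assms unfolding finite_part_def by auto
  obtain \<sigma> \<tau> where r: "set \<sigma> \<subseteq> tuples" "set \<tau> \<subseteq> tuples" "concat \<sigma> = concat \<tau>"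
    "map sum_list \<sigma> = s" "map sum_list \<tau> = t" "\<sigma> \<noteq> []" "\<tau> \<noteq> []" "concat \<tau> \<in> J T"
    using s(1) t(1) by (rule common_tuple)
  show ?thesis
  proof (rule that)
    show "refine_str E \<sigma> x \<in> sp E (concat \<tau>)" "refine_str E \<tau> w \<in> sp E (concat \<tau>)"
      using refine_str_in[of \<sigma> x] refine_str_in[of \<tau> w] r s t by simp_all
    show "y = \<iota> (concat \<tau>) (refine_str E \<sigma> x)" "z = \<iota> (concat \<tau>) (refine_str E \<tau> w)"
      using iota_refine[of \<sigma> x] iota_refine[of \<tau> w] r s t by simp_all
  qed (rule r(8))
qed

lemma csubspace_finite_part:
  assumes "0 < T"
  shows "csubspace (finite_part T)"
proof (rule csubspaceI)
  have T: "[T] \<in> J T" using assms by (simp add: J_def)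
  have "\<iota> [T] 0 = 0"
    using iota_isometry[OF tuple_of_J[OF T]] csubspace_sp[OF tuple_of_J[OF T]]
    by (intro clinear_on_0) (auto simp: isometry_on_def)
  thus "0 \<in> finite_part T"
    using T csubspace_0[OF csubspace_sp[OF tuple_of_J[OF T]]] unfolding finite_part_def
    by (metis UN_iff imageI)
next
  fix y z assume "y \<in> finite_part T" "z \<in> finite_part T"
  then obtain r x w where r: "r \<in> J T" "x \<in> sp E r" "w \<in> sp E r" "y = \<iota> r x" "z = \<iota> r w"
    by (rule finite_part_pair)
  have "y + z = \<iota> r (x + w)"
    using iota_isometry[OF tuple_of_J[OF r(1)]] r by (simp add: isometry_on_def clinear_on_def)
  moreover have "x + w \<in> sp E r"
    by (rule csubspace_add[OF csubspace_sp[OF tuple_of_J[OF r(1)]] r(2,3)])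
  ultimately show "y + z \<in> finite_part T" using r(1) unfolding finite_part_def by blast
next
  fix c y assume "y \<in> finite_part T"
  then obtain s x where s: "s \<in> J T" "x \<in> sp E s" "y = \<iota> s x" unfolding finite_part_def by auto
  hence "scaleC c y = \<iota> s (scaleC c x)"
    using iota_isometry[OF tuple_of_J[OF s(1)]] by (simp add: isometry_on_def clinear_on_def)
  moreover have "scaleC c x \<in> sp E s"
    by (rule csubspace_scale[OF csubspace_sp[OF tuple_of_J[OF s(1)]] s(2)])
  ultimately show "scaleC c y \<in> finite_part T" using s(1) unfolding finite_part_def by blast
qed

text \<open>Tuples with a break at \<open>S\<close> are cofinal, since any tuple has a common
  refinement with \<open>[S, T]\<close>. On vectors over such tuples the structure map of
  \<open>F\<close> is known explicitly.\<close>

lemma finite_part_split: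
  assumes "0 < S" "0 < T" "y \<in> finite_part (S + T)"
  obtains s t x where "s \<in> J S" "t \<in> J T" "x \<in> sp E (s @ t)" "y = \<iota> (s @ t) x"
proof -
  obtain r x where r: "r \<in> J (S + T)" "x \<in> sp E r" "y = \<iota> r x"
    using assms(3) unfolding finite_part_def by auto
  have "[S, T] \<in> J (S + T)" using assms by (simp add: J_def)
  with r(1) obtain \<sigma> \<tau> where st: "set \<sigma> \<subseteq> tuples" "set \<tau> \<subseteq> tuples" "concat \<sigma> = concat \<tau>"
    "map sum_list \<sigma> = r" "map sum_list \<tau> = [S, T]" "\<sigma> \<noteq> []" "\<tau> \<noteq> []" "concat \<tau> \<in> J (S + T)"
    by (rule common_tuple)
  have "length \<tau> = 2" using arg_cong[OF st(5), of length] by simp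
  then obtain s t where tau: "\<tau> = [s, t]"
    by (metis (no_types) One_nat_def Suc_1 length_0_conv length_Suc_conv)
  have "s \<in> J S" "t \<in> J T" using st(2,5) unfolding tau by (simp_all add: J_iff)
  moreover have "concat \<sigma> = s @ t" using st(3) unfolding tau by simp
  moreover have x: "x \<in> sp E (map sum_list \<sigma>)" using r(2) st(4) by simp
  hence "y = \<iota> (concat \<sigma>) (refine_str E \<sigma> x)" using iota_refine[OF st(6,1)] r(3) st(4) by simp
  ultimately show ?thesis using that refine_str_in[OF st(6,1) x] by metis
qed

lemma eq_on_finite_part:
  assumes "0 < T" "p \<in> sp F [T]" "q \<in> sp F [T]"
    and "\<And>ts x. ts \<in> J T \<Longrightarrow> x \<in> sp E ts \<Longrightarrow> cinner p (\<iota> ts x) = cinner q (\<iota> ts x)"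
  shows "p = q"
proof (rule cinner_eqI[OF csubspace_F[OF assms(1)] assms(2,3)])
  fix z assume "z \<in> sp F [T]"
  hence z: "z \<in> closure (finite_part T)" using closure_finite_part[OF assms(1)] by simp
  show "cinner p z = cinner q z"
    by (rule cinner_eq_closure[OF _ z]) (auto simp: finite_part_def assms(4))
qed

section \<open>The lift of the unit and the compression map\<close>

lemma unit_hat: "u_hat \<in> units F" and compress_u_hat: "compress E \<iota> u_hat = u"
  using lift by (simp_all add: is_lift_def)

lemma unit_hat_in: "0 < t \<Longrightarrow> u_hat t \<in> sp F [t]"
  using unit_hat by (auto simp: units_def sections_def)

lemma iota_single_isometry: "0 < t \<Longrightarrow> isometry_on (sp E [t]) (sp F [t]) (\<iota> [t])"
  using iota_isometry[of "[t]"] by (simp add: tuples_iff)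

lemma hilbert_sp_single: "0 < t \<Longrightarrow> hilbert_subspace (sp E [t])"
  by (rule hilbert_sp) (simp add: tuples_iff)

lemmas adjoint_iota = adjoint_on_isometry[OF hilbert_sp_single iota_single_isometry]

lemma compress_in: "0 < t \<Longrightarrow> compress E \<iota> b t \<in> sp E [t]"
  using adjoint_iota(1) by (simp add: compress_def)

lemma cinner_compress:
  "0 < t \<Longrightarrow> x \<in> sp E [t] \<Longrightarrow> cinner (compress E \<iota> b t) x = cinner (b t) (\<iota> [t] x)"
  using adjoint_iota(2) by (simp add: compress_def)

lemma norm_compress: "0 < t \<Longrightarrow> norm (compress E \<iota> b t) \<le> norm (b t)"
  using adjoint_iota(3) by (simp add: compress_def)

lemma compress_section: "compress E \<iota> b \<in> sections E"
  using compress_in by (auto simp: sections_def PiE_iff) (simp add: compress_def)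

text \<open>The unit equation of \<open>F\<close> and \<open>cinner_tensor_iota\<close> cut off the
  first entry; for a single entry the value is given by \<open>is_lift\<close>.\<close>

lemma cinner_unit_hat:
  "ts \<in> tuples \<Longrightarrow> x \<in> sp E ts \<Longrightarrow> cinner (u_hat (sum_list ts)) (\<iota> ts x) = cinner (unit_tensor E u ts) x"
proof (induction ts arbitrary: x rule: tuples_induct)
  case (single t)
  thus ?case using cinner_compress[of t x u_hat] compress_u_hat by simp
next
  case (Cons t ts)
  let ?T = "sum_list ts"
  have pos: "0 < ?T" and ne: "ts \<noteq> []" and t: "[t] \<in> tuples"
    using Cons.hyps sum_list_tuples_pos by (auto simp: tuples_iff)
  have x: "x \<in> sp E ([t] @ ts)" using Cons.prems by simp
  have "\<iota> (t # ts) x \<in> sp F [t + ?T]" using iota_in[of "t # ts" x] Cons by (simp add: tuples_iff)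
  moreover have "u_hat (t + ?T) = str_adj F t ?T (ten F [t] [?T] (u_hat t) (u_hat ?T))"
    using unit_hat Cons.hyps(1) pos by (simp add: units_def)
  ultimately have "cinner (u_hat (t + ?T)) (\<iota> (t # ts) x) =
      cinner (ten F [t] [?T] (u_hat t) (u_hat ?T)) (str F t ?T (\<iota> (t # ts) x))"
    using str_adj_cinner[OF incl_F Cons.hyps(1) pos] by simp
  also have "\<dots> = cinner (ten E [t] ts (u t) (unit_tensor E u ts)) x"
    using cinner_tensor_iota[OF t Cons.hyps(2) _ _ _ _ _ _ x, of "u_hat t" "u t" "u_hat ?T" "unit_tensor E u ts"]
      Cons pos unit_hat_in unit_in unit_tensor_in cinner_compress[of t _ u_hat] compress_u_hat by simp
  finally show ?case by (simp add: unit_tensor_Cons[OF ne])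
qed

text \<open>By \<open>iter_str_unit\<close>, \<open>\<iota> [T] (u T)\<close> is also the image of
  the unit tensor over every tuple in \<open>J T\<close>, so it has the same coordinates as
  \<open>u_hat T\<close>.\<close>

lemma unit_hat_eq:
  assumes "0 < T"
  shows "u_hat T = \<iota> [T] (u T)"
proof (rule eq_on_finite_part[OF assms unit_hat_in[OF assms]])
  show "\<iota> [T] (u T) \<in> sp F [T]" using iota_in[of "[T]" "u T"] unit_in assms by (simp add: tuples_iff)
  fix ts x assume "ts \<in> J T" and x: "x \<in> sp E ts"
  hence ts: "ts \<in> tuples" "sum_list ts = T" by (auto simp: J_iff)
  have "\<iota> [T] (u T) = \<iota> ts (unit_tensor E u ts)"
    using iota_refine[of "[ts]" "u T"] ts iter_str_unit[OF ts(1)] unit_in[OF assms] by simp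
  hence "cinner (\<iota> [T] (u T)) (\<iota> ts x) = cinner (unit_tensor E u ts) x"
    using isometry_on_cinner[OF iota_isometry[OF ts(1)] csubspace_sp[OF ts(1)] unit_tensor_in[OF ts(1)] x]
    by simp
  thus "cinner (u_hat T) (\<iota> ts x) = cinner (\<iota> [T] (u T)) (\<iota> ts x)"
    using cinner_unit_hat[OF ts(1) x] ts(2) by simp
qed

text \<open>The Leibniz rule seen from \<open>F\<close>. As only the coordinates of \<open>b\<close>
  over \<open>s\<close> and \<open>t\<close> enter, it serves both for a given addit of
  \<open>F\<close> and for the section still to be shown an addit.\<close>

lemma cinner_tensor_sum_iota:
  assumes st: "s \<in> tuples" "t \<in> tuples" and a: "a \<in> sections E"
    and b: "b (sum_list s) \<in> sp F [sum_list s]" "b (sum_list t) \<in> sp F [sum_list t]"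
    "\<And>x. x \<in> sp E s \<Longrightarrow> cinner (b (sum_list s)) (\<iota> s x) = cinner (addit_tensor E u a s) x"
    "\<And>x. x \<in> sp E t \<Longrightarrow> cinner (b (sum_list t)) (\<iota> t x) = cinner (addit_tensor E u a t) x"
    and x: "x \<in> sp E (s @ t)"
  shows "cinner (ten F [sum_list s] [sum_list t] (b (sum_list s)) (u_hat (sum_list t)) +
      ten F [sum_list s] [sum_list t] (u_hat (sum_list s)) (b (sum_list t)))
    (str F (sum_list s) (sum_list t) (\<iota> (s @ t) x)) = cinner (addit_tensor E u a (s @ t)) x"
proof -
  let ?S = "sum_list s" and ?T = "sum_list t"
  note dual = cinner_tensor_iota[OF st _ _ _ _ _ _ x]
  note mem = b unit_hat_in unit_tensor_in addit_tensor_in[OF a] sum_list_tuples_pos cinner_unit_hat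
  have "cinner (ten F [?S] [?T] (b ?S) (u_hat ?T)) (str F ?S ?T (\<iota> (s @ t) x)) =
      cinner (ten E s t (addit_tensor E u a s) (unit_tensor E u t)) x"
    using mem st by (intro dual) simp_all
  moreover have "cinner (ten F [?S] [?T] (u_hat ?S) (b ?T)) (str F ?S ?T (\<iota> (s @ t) x)) =
      cinner (ten E s t (unit_tensor E u s) (addit_tensor E u a t)) x"
    using mem st by (intro dual) simp_all
  ultimately show ?thesis by (simp add: cinner_add_left addit_tensor_append[OF a st])
qed

text \<open>As for the unit, the first entry is cut off, now with the addit equation of
  \<open>F\<close>. Hence the compression determines all coordinates of \<open>b\<close>.\<close>

lemma cinner_addit_hat:
  assumes b: "b \<in> addits F u_hat"
  shows "ts \<in> tuples \<Longrightarrow> x \<in> sp E ts \<Longrightarrow>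
    cinner (b (sum_list ts)) (\<iota> ts x) = cinner (addit_tensor E u (compress E \<iota> b) ts) x"
proof (induction ts arbitrary: x rule: tuples_induct)
  case (single t)
  thus ?case using cinner_compress[of t x b] by simp
next
  case (Cons t ts)
  let ?T = "sum_list ts"
  have pos: "0 < ?T" and t: "[t] \<in> tuples"
    using Cons.hyps sum_list_tuples_pos by (auto simp: tuples_iff)
  have x: "x \<in> sp E ([t] @ ts)" using Cons.prems by simp
  have b_in: "b r \<in> sp F [r]" if "0 < r" for r using b that by (auto simp: addits_def sections_def)
  have "\<iota> (t # ts) x \<in> sp F [t + ?T]" using iota_in[of "t # ts" x] Cons by (simp add: tuples_iff)
  moreover have "b (t + ?T) = str_adj F t ?T (ten F [t] [?T] (b t) (u_hat ?T) + ten F [t] [?T] (u_hat t) (b ?T))"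
    using b Cons.hyps(1) pos by (simp add: addits_def)
  ultimately have "cinner (b (t + ?T)) (\<iota> (t # ts) x) =
      cinner (ten F [t] [?T] (b t) (u_hat ?T) + ten F [t] [?T] (u_hat t) (b ?T)) (str F t ?T (\<iota> (t # ts) x))"
    using str_adj_cinner[OF incl_F Cons.hyps(1) pos] by simp
  also have "\<dots> = cinner (addit_tensor E u (compress E \<iota> b) ([t] @ ts)) x"
    using cinner_tensor_sum_iota[OF t Cons.hyps(2) compress_section _ _ _ _ x, of b b]
      Cons pos b_in cinner_compress[of t _ b] by simp
  finally show ?case by simp
qed

section \<open>Compression of addits and its injectivity\<close>

lemma compress_addit:
  assumes b: "b \<in> addits F u_hat"
  shows "compress E \<iota> b \<in> addits E u"
proof -
  let ?a = "compress E \<iota> b"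
  obtain k where k: "0 \<le> k" "\<And>t. 0 < t \<Longrightarrow> (norm (b t))\<^sup>2 \<le> k * (t + t\<^sup>2)"
    using b by (auto simp: addits_def)
  have "(norm (?a t))\<^sup>2 \<le> k * (t + t\<^sup>2)" if "0 < t" for t
    using power_mono[OF norm_compress[OF that, of b] norm_ge_zero, of 2] k(2)[OF that] by linarith
  moreover have "?a (s + t) = str_adj E s t (ten E [s] [t] (?a s) (u t) + ten E [s] [t] (u s) (?a t))"
    if st: "0 < s" "0 < t" for s t
    unfolding str_adj_def
  proof (rule sym, rule adjoint_on_eqI)
    have tup: "[s + t] \<in> tuples" "[s, t] \<in> tuples" using st by (simp_all add: tuples_iff)
    show "csubspace (sp E [s + t])" using tup by (intro csubspace_sp)
    show "?a (s + t) \<in> sp E [s + t]" using st by (intro compress_in) simp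
    fix x assume x: "x \<in> sp E [s + t]"
    have str: "str E s t x \<in> sp E [s, t]" using str_isometry[OF st] x by (auto simp: isometry_on_def)
    have "cinner (?a (s + t)) x = cinner (b (s + t)) (\<iota> [s + t] x)"
      using cinner_compress[of "s + t" x b] st x by simp
    \<comment> \<open>Refining \<open>[s + t]\<close> to \<open>[s, t]\<close> leads to the
      coordinate of \<open>b\<close> over \<open>[s, t]\<close>, which is the vector in the addit
      equation.\<close>
    also have "\<iota> [s + t] x = \<iota> [s, t] (str E s t x)"
      using iota_refine[of "[[s, t]]" x] tup x iter_str_pair[OF st x] by (simp del: iter_str.simps)
    also have "cinner (b (s + t)) \<dots> = cinner (addit_tensor E u ?a [s, t]) (str E s t x)"
      using cinner_addit_hat[OF b tup(2) str] by simp
    finally show "cinner (?a (s + t)) x =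
        cinner (ten E [s] [t] (?a s) (u t) + ten E [s] [t] (u s) (?a t)) (str E s t x)" by simp
  qed
  ultimately show ?thesis using compress_section k(1) unfolding addits_def by blast
qed

text \<open>Equal compressions force equal coordinates over all tuples, and these determine the
  vector by density.\<close>

lemma compress_inj: "inj_on (compress E \<iota>) (addits F u_hat)"
proof (rule inj_onI)
  fix b c assume b: "b \<in> addits F u_hat" and c: "c \<in> addits F u_hat"
    and eq: "compress E \<iota> b = compress E \<iota> c"
  have sec: "b \<in> sections F" "c \<in> sections F" using b c by (simp_all add: addits_def)
  have "b t = c t" if "0 < t" for t
  proof (rule eq_on_finite_part[OF that])
    show "b t \<in> sp F [t]" "c t \<in> sp F [t]" using sec that by (auto simp: sections_def)
    fix ts x assume "ts \<in> J t" "x \<in> sp E ts"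
    thus "cinner (b t) (\<iota> ts x) = cinner (c t) (\<iota> ts x)"
      using cinner_addit_hat[OF b, of ts x] cinner_addit_hat[OF c, of ts x] eq by (simp add: J_iff)
  qed
  thus "b = c" using sec unfolding sections_def by (intro PiE_ext[of b _ _ c]) auto
qed

section \<open>Lifting addits and roots\<close>

lemma addit_lift_at:
  assumes a: "a \<in> addits E u" and T: "0 < T"
    and k: "0 \<le> k" "\<And>t. 0 < t \<Longrightarrow> (norm (a t))\<^sup>2 \<le> k * (t + t\<^sup>2)"
  shows "\<exists>b\<in>sp F [T]. (\<forall>ts\<in>J T. \<forall>x\<in>sp E ts. cinner b (\<iota> ts x) = cinner (addit_tensor E u a ts) x) \<and>
    (norm b)\<^sup>2 \<le> 2 * k * (T + T\<^sup>2)"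
proof -
  interpret pointed_addit E u a by unfold_locales (rule a)
  let ?A = "addit_tensor E u a"
  \<comment> \<open>Well-definedness of the functional: over a common refinement the two
    representatives coincide, since \<open>\<iota>\<close> is injective there, and refinement
    preserves the pairing with addit tensors.\<close>
  have wd: "cinner (?A s) x = cinner (?A t) y"
    if s: "s \<in> J T" "x \<in> sp E s" and t: "t \<in> J T" "y \<in> sp E t" and eq: "\<iota> s x = \<iota> t y" for s t x y
  proof -
    obtain \<sigma> \<tau> where r: "set \<sigma> \<subseteq> tuples" "set \<tau> \<subseteq> tuples" "concat \<sigma> = concat \<tau>"
      "map sum_list \<sigma> = s" "map sum_list \<tau> = t" "\<sigma> \<noteq> []" "\<tau> \<noteq> []" "concat \<tau> \<in> J T"
      using s(1) t(1) by (rule common_tuple)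
    let ?r = "concat \<tau>" and ?x = "refine_str E \<sigma> x" and ?y = "refine_str E \<tau> y"
    have mem: "?x \<in> sp E ?r" "?y \<in> sp E ?r"
      using refine_str_in[of \<sigma> x] refine_str_in[of \<tau> y] r s t by simp_all
    have iso: "isometry_on (sp E ?r) (sp F [sum_list ?r]) (\<iota> ?r)"
      using iota_isometry[OF tuple_of_J[OF r(8)]] .
    have sub: "csubspace (sp E ?r)" using csubspace_sp[OF tuple_of_J[OF r(8)]] .
    have "\<iota> ?r ?x = \<iota> ?r ?y"
      using iota_refine[of \<sigma> x] iota_refine[of \<tau> y] r s t eq by simp
    moreover have "clinear_on (sp E ?r) (\<iota> ?r)" using iso by (simp add: isometry_on_def)
    ultimately have "\<iota> ?r (?x - ?y) = 0" by (simp add: clinear_on_diff[OF _ sub mem])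
    hence "?x = ?y" using iso csubspace_diff[OF sub mem] unfolding isometry_on_def
      by (metis eq_iff_diff_eq_0 norm_eq_zero norm_zero)
    thus ?thesis
      using cinner_addit_refine_str[of \<sigma> x] cinner_addit_refine_str[of \<tau> y] r s t by simp
  qed
  define \<phi> where "\<phi> y = (THE c. \<exists>ts\<in>J T. \<exists>x\<in>sp E ts. y = \<iota> ts x \<and> c = cinner (?A ts) x)" for y
  have \<phi>: "\<phi> (\<iota> ts x) = cinner (?A ts) x" if "ts \<in> J T" "x \<in> sp E ts" for ts x
    unfolding \<phi>_def
  proof (rule the_equality)
    show "\<exists>t\<in>J T. \<exists>y\<in>sp E t. \<iota> ts x = \<iota> t y \<and> cinner (?A ts) x = cinner (?A t) y"
      using that by blast
    fix c assume "\<exists>t\<in>J T. \<exists>y\<in>sp E t. \<iota> ts x = \<iota> t y \<and> c = cinner (?A t) y"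
    then obtain t y where t: "t \<in> J T" "y \<in> sp E t" and eq: "\<iota> ts x = \<iota> t y" and c: "c = cinner (?A t) y"
      by (elim bexE conjE)
    show "c = cinner (?A ts) x" unfolding c using wd[OF that t eq] by (rule sym)
  qed
  \<comment> \<open>With this root the norm bound on the Riesz vector squares to the growth bound of
    an addit.\<close>
  define K where "K = sqrt (2 * k * (T + T\<^sup>2))"
  have nonneg: "0 \<le> 2 * k * (T + T\<^sup>2)" using k(1) T by (intro mult_nonneg_nonneg) auto
  have D: "csubspace (finite_part T)" using T by (rule csubspace_finite_part)
  have add: "\<phi> (y + z) = \<phi> y + \<phi> z" if yz: "y \<in> finite_part T" "z \<in> finite_part T" for y z
  proof -
    obtain r x w where r: "r \<in> J T" "x \<in> sp E r" "w \<in> sp E r" "y = \<iota> r x" "z = \<iota> r w"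
      by (rule finite_part_pair[OF yz])
    have "y + z = \<iota> r (x + w)"
      using iota_isometry[OF tuple_of_J[OF r(1)]] r by (simp add: isometry_on_def clinear_on_def)
    thus ?thesis
      using r csubspace_add[OF csubspace_sp[OF tuple_of_J[OF r(1)]] r(2,3)]
      by (simp add: \<phi> cinner_add_right)
  qed
  have scale: "\<phi> (scaleC c y) = c * \<phi> y" if y: "y \<in> finite_part T" for c y
  proof -
    obtain r x where r: "r \<in> J T" "x \<in> sp E r" "y = \<iota> r x" using y unfolding finite_part_def by auto
    have "scaleC c y = \<iota> r (scaleC c x)"
      using iota_isometry[OF tuple_of_J[OF r(1)]] r by (simp add: isometry_on_def clinear_on_def)
    thus ?thesis
      using r csubspace_scale[OF csubspace_sp[OF tuple_of_J[OF r(1)]] r(2)]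
      by (simp add: \<phi> cinner_scaleC_right)
  qed
  have bound: "cmod (\<phi> y) \<le> K * norm y" if y: "y \<in> finite_part T" for y
  proof -
    obtain r x where r: "r \<in> J T" "x \<in> sp E r" "y = \<iota> r x" using y unfolding finite_part_def by auto
    have "(norm (?A r))\<^sup>2 \<le> 2 * k * (T + T\<^sup>2)"
      using norm_addit_tensor_le[OF k tuple_of_J[OF r(1)]] r(1) by (simp add: J_iff)
    hence "norm (?A r) \<le> K" unfolding K_def by (rule real_le_rsqrt)
    moreover have "norm y = norm x"
      using iota_isometry[OF tuple_of_J[OF r(1)]] r by (simp add: isometry_on_def)
    ultimately show ?thesis
      using cauchy_schwarz[of "?A r" x] mult_right_mono[of "norm (?A r)" K "norm x"] r
      by (simp add: \<phi>)
  qed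
  have "0 \<le> K" using nonneg by (simp add: K_def)
  then obtain b where b: "b \<in> closure (finite_part T)" "\<forall>y\<in>finite_part T. cinner b y = \<phi> y" "norm b \<le> K"
    using riesz_representation[of "finite_part T" \<phi>, OF D add scale bound] by blast
  have "cinner b (\<iota> ts x) = cinner (?A ts) x" if "ts \<in> J T" "x \<in> sp E ts" for ts x
    using b(2) \<phi>[OF that] that unfolding finite_part_def by auto
  moreover have "(norm b)\<^sup>2 \<le> 2 * k * (T + T\<^sup>2)"
    using power_mono[OF b(3), of 2] nonneg by (simp add: K_def)
  ultimately show ?thesis using b(1) closure_finite_part[OF T] by blast
qed

lemma compress_surj:
  assumes a: "a \<in> addits E u"
  obtains b where "b \<in> addits F u_hat" "compress E \<iota> b = a"
proof -
  interpret pointed_addit E u a by unfold_locales (rule a)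
  let ?A = "addit_tensor E u a"
  obtain k where k: "0 \<le> k" "\<And>t. 0 < t \<Longrightarrow> (norm (a t))\<^sup>2 \<le> k * (t + t\<^sup>2)"
    using a by (auto simp: addits_def)
  define P where "P T b \<longleftrightarrow> b \<in> sp F [T] \<and>
    (\<forall>ts\<in>J T. \<forall>x\<in>sp E ts. cinner b (\<iota> ts x) = cinner (?A ts) x) \<and> (norm b)\<^sup>2 \<le> 2 * k * (T + T\<^sup>2)" for T b
  define b where "b = (\<lambda>T\<in>{0<..}. SOME b. P T b)"
  have "P T (b T)" if "0 < T" for T
    using someI_ex[of "P T"] addit_lift_at[OF a that k] that unfolding b_def P_def by auto
  hence b_in: "b T \<in> sp F [T]" and b_norm: "(norm (b T))\<^sup>2 \<le> 2 * k * (T + T\<^sup>2)"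
    and b_iota: "\<And>ts x. ts \<in> J T \<Longrightarrow> x \<in> sp E ts \<Longrightarrow> cinner (b T) (\<iota> ts x) = cinner (?A ts) x"
    if "0 < T" for T
    using that unfolding P_def by blast+
  have sec: "b \<in> sections F"
    using b_in by (auto simp: sections_def PiE_iff) (simp add: b_def)
  \<comment> \<open>Both sides lie in the fibre over \<open>S + T\<close>, so it suffices to test on
    the finite part. There every vector has a representative with a break at \<open>S\<close>, to
    which \<open>cinner_tensor_sum_iota\<close> applies.\<close>
  have "b (S + T) = str_adj F S T (ten F [S] [T] (b S) (u_hat T) + ten F [S] [T] (u_hat S) (b T))"
    (is "_ = str_adj F S T ?w") if ST: "0 < S" "0 < T" for S T
  proof -
    have pos: "0 < S + T" using ST by simp
    have adj: "str_adj F S T ?w \<in> sp F [S + T]" using str_adj_in[OF incl_F ST] .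
    show ?thesis
    proof (rule cinner_eqI[OF csubspace_F[OF pos] b_in[OF pos] adj])
      fix z assume "z \<in> sp F [S + T]"
      hence z: "z \<in> closure (finite_part (S + T))" using closure_finite_part[OF pos] by simp
      show "cinner (b (S + T)) z = cinner (str_adj F S T ?w) z"
      proof (rule cinner_eq_closure[OF _ z])
        fix y assume y: "y \<in> finite_part (S + T)"
        obtain s t x where st: "s \<in> J S" "t \<in> J T" and x: "x \<in> sp E (s @ t)" and y_eq: "y = \<iota> (s @ t) x"
          by (rule finite_part_split[OF ST y])
        have tup: "s \<in> tuples" "t \<in> tuples" "sum_list s = S" "sum_list t = T" "s @ t \<in> J (S + T)"
          using st by (auto simp: J_iff tuples_iff)
        have "y \<in> sp F [S + T]"
          using y closure_subset[of "finite_part (S + T)"] closure_finite_part[OF pos] by blast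
        hence "cinner (str_adj F S T ?w) y = cinner ?w (str F S T y)"
          using str_adj_cinner[OF incl_F ST] by blast
        also have "\<dots> = cinner (?A (s @ t)) x"
          using cinner_tensor_sum_iota[OF tup(1,2) addit_section, of b x] b_in b_iota ST st x tup y_eq by simp
        also have "\<dots> = cinner (b (S + T)) y" using b_iota[OF pos tup(5) x] y_eq by simp
        finally show "cinner (b (S + T)) y = cinner (str_adj F S T ?w) y" by simp
      qed
    qed
  qed
  \<comment> \<open>The growth constant \<open>2 * k\<close> stems from
    \<open>norm_addit_tensor_le\<close>.\<close>
  hence "b \<in> addits F u_hat"
    using sec b_norm k(1) unfolding addits_def by (auto intro!: exI[of _ "2 * k"])
  moreover have "compress E \<iota> b = a"
  proof -
    have "compress E \<iota> b t = a t" if "0 < t" for t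
    proof (rule cinner_eqI)
      show "csubspace (sp E [t])" using that by (intro csubspace_sp) (simp add: tuples_iff)
      show "compress E \<iota> b t \<in> sp E [t]" "a t \<in> sp E [t]" using that compress_in addit_in by auto
      fix x assume "x \<in> sp E [t]"
      thus "cinner (compress E \<iota> b t) x = cinner (a t) x"
        using cinner_compress[OF that] b_iota[OF that, of "[t]" x] that by (simp add: J_def)
    qed
    thus ?thesis
      using compress_section[of b] addit_section unfolding sections_def
      by (intro PiE_ext[of "compress E \<iota> b" _ _ a]) auto
  qed
  ultimately show ?thesis by (rule that)
qed

lemma bij_betw_compress: "bij_betw (compress E \<iota>) (addits F u_hat) (addits E u)"
  using compress_inj compress_addit compress_surj by (intro bij_betw_imageI) (auto, metis imageI)

text \<open>As \<open>u_hat t = \<iota> [t] (u t)\<close>, passing to the adjoint of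
  \<open>\<iota> [t]\<close> turns the pairing of the lift with \<open>u_hat t\<close> into
  \<open>cinner (a t) (u t)\<close>.\<close>

lemma root_lift:
  assumes a: "a \<in> roots E u"
  shows "the_inv_into (addits F u_hat) (compress E \<iota>) a \<in> roots F u_hat"
proof -
  obtain b where b: "b \<in> addits F u_hat" "compress E \<iota> b = a"
    using compress_surj[of a] a by (auto simp: roots_def)
  have "cinner (b t) (u_hat t) = 0" if "0 < t" for t
    using cinner_compress[OF that unit_in[OF that], of b] b(2) a that
    by (simp add: unit_hat_eq roots_def)
  thus ?thesis
    using b the_inv_into_f_f[OF compress_inj b(1)] by (simp add: roots_def)
qed

end

theorem proposition4p2:
  fixes E :: "'a::chilbert_space tensor_system"
    and F :: "'b::chilbert_space tensor_system"
    and \<iota> :: "real list \<Rightarrow> 'a \<Rightarrow> 'b"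
    and u :: "real \<Rightarrow> 'a" and u_hat :: "real \<Rightarrow> 'b"
  assumes "pointed_inclusion_system E u"
    and "generated_product_system E F \<iota>"
    and "is_lift E F \<iota> u u_hat"
  shows "bij_betw (compress E \<iota>) (addits F u_hat) (addits E u) \<and>
    (\<forall>a\<in>roots E u. the_inv_into (addits F u_hat) (compress E \<iota>) a \<in> roots F u_hat)"
proof -
  interpret generated E u F \<iota> u_hat
    using assms by unfold_locales
  show ?thesis using bij_betw_compress root_lift by blast
qed

end
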